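(* Let $N$ be a positive integer. Then the following are equivalent. (1) For all positive even integers $k$, $M_k(\Gamma_0(N)) \subset \mathcal{E}_k(\Gamma_0(N))$; in other words, every element of $M_k(\Gamma_0(N))$ is expressible as a linear combination of weakly holomorphic weight $k$ eta-quotients of level $N$ with poles only at infinity. (2) $\mathcal{R}_k(\Gamma_0(N)) = \mathcal{E}_k(\Gamma_0(N))$ for all non-negative even integers $k$. (3) $\mathcal{R}_2(\Gamma_0(N)) = \mathcal{E}_2(\Gamma_0(N))$.
   Context: $\eta(z) = q^{1/24}\prod_{n\ge 1}(1-q^n)$, $q = e^{2\pi i z}$, for $z$ in the upper half plane $\mathbb{H}$. An eta-quotient of level $N$ is a function $\prod_{\delta \mid N}\eta(\delta z)^{r_\delta}$ with $r_\delta \in \mathbb{Z}$. $M_k(\Gamma_0(N))$ is the complex vector space of holomorphic modular forms of weight $k$ (trivial character) for $\Gamma_0(N)$. A weakly holomorphic modular form of weight $k$ for $\Gamma_0(N)$ obeys the weight $k$ transformation law for $\Gamma_0(N)$, is holomorphic on $\mathbb{H}$ and meromorphic at the cusps. $\mathcal{R}_k(\Gamma_0(N))$ is the complex vector space of weakly holomorphic modular forms of weight $k$ for $\Gamma_0(N)$ that are holomorphic at every cusp other than $\infty$ (a pole at $\infty$ is allowed but not required). $\mathcal{E}_k(\Gamma_0(N))$ is the subspace of $\mathcal{R}_k(\Gamma_0(N))$ spanned by the eta-quotients of level $N$ that lie in $\mathcal{R}_k(\Gamma_0(N))$. *)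

theory Defs
  imports
    "HOL-Complex_Analysis.Complex_Analysis"
    "HOL-Library.Function_Algebras"
begin

definition upper_half_plane :: "complex set" where
  "upper_half_plane = {z. Im z > 0}"

definition SL2Z :: "(int ^ 2 ^ 2) set" where
  "SL2Z = {A. det A = 1}"

definition Gamma0 :: "nat \<Rightarrow> (int ^ 2 ^ 2) set" where
  "Gamma0 N = {A \<in> SL2Z. int N dvd A $ 2 $ 1}"

definition moebius :: "int ^ 2 ^ 2 \<Rightarrow> complex \<Rightarrow> complex" where
  "moebius A z = (of_int (A $ 1 $ 1) * z + of_int (A $ 1 $ 2)) /
                 (of_int (A $ 2 $ 1) * z + of_int (A $ 2 $ 2))"

(* The weight k slash operator for matrices of determinant 1. *)
definition slash :: "int \<Rightarrow> int ^ 2 ^ 2 \<Rightarrow> (complex \<Rightarrow> complex) \<Rightarrow> complex \<Rightarrow> complex" where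
  "slash k A f z =
     (of_int (A $ 2 $ 1) * z + of_int (A $ 2 $ 2)) powi (- k) * f (moebius A z)"

(* The projective line over the rationals is rendered as rat option; None is the point infinity. *)
fun moebius_cusp :: "int ^ 2 ^ 2 \<Rightarrow> rat option \<Rightarrow> rat option" where
  "moebius_cusp A None =
     (if A $ 2 $ 1 = 0 then None else Some (of_int (A $ 1 $ 1) / of_int (A $ 2 $ 1)))"
| "moebius_cusp A (Some x) =
     (if of_int (A $ 2 $ 1) * x + of_int (A $ 2 $ 2) = 0 then None
      else Some ((of_int (A $ 1 $ 1) * x + of_int (A $ 1 $ 2)) /
                 (of_int (A $ 2 $ 1) * x + of_int (A $ 2 $ 2))))"

definition cusp_equiv :: "nat \<Rightarrow> rat option \<Rightarrow> rat option \<Rightarrow> bool" where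
  "cusp_equiv N s t \<longleftrightarrow> (\<exists>A\<in>Gamma0 N. moebius_cusp A s = t)"

(* Behaviour at i*infinity: f is a function g of the local parameter exp(2 pi i z / h),
   where g is meromorphic, respectively holomorphic, in a neighbourhood of 0. *)
definition meromorphic_at_infinity :: "(complex \<Rightarrow> complex) \<Rightarrow> bool" where
  "meromorphic_at_infinity f \<longleftrightarrow>
     (\<exists>(h::nat) g. h > 0 \<and> g meromorphic_on {0} \<and>
        (\<forall>z\<in>upper_half_plane. f z = g (exp (2 * of_real pi * \<i> * z / of_nat h))))"

definition holomorphic_at_infinity :: "(complex \<Rightarrow> complex) \<Rightarrow> bool" where
  "holomorphic_at_infinity f \<longleftrightarrow>
     (\<exists>(h::nat) g. h > 0 \<and> g analytic_on {0} \<and>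
        (\<forall>z\<in>upper_half_plane. f z = g (exp (2 * of_real pi * \<i> * z / of_nat h))))"

definition meromorphic_at_cusp :: "int \<Rightarrow> (complex \<Rightarrow> complex) \<Rightarrow> rat option \<Rightarrow> bool" where
  "meromorphic_at_cusp k f s \<longleftrightarrow>
     (\<forall>A\<in>SL2Z. moebius_cusp A None = s \<longrightarrow> meromorphic_at_infinity (slash k A f))"

definition holomorphic_at_cusp :: "int \<Rightarrow> (complex \<Rightarrow> complex) \<Rightarrow> rat option \<Rightarrow> bool" where
  "holomorphic_at_cusp k f s \<longleftrightarrow>
     (\<forall>A\<in>SL2Z. moebius_cusp A None = s \<longrightarrow> holomorphic_at_infinity (slash k A f))"

(* A function on the upper half plane is represented by its extension by 0 to all complex
   numbers, so that equality and linear combinations are those of functions on the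
   upper half plane. *)
definition weakly_holomorphic_form :: "nat \<Rightarrow> int \<Rightarrow> (complex \<Rightarrow> complex) \<Rightarrow> bool" where
  "weakly_holomorphic_form N k f \<longleftrightarrow>
     (\<forall>z. z \<notin> upper_half_plane \<longrightarrow> f z = 0) \<and>
     f holomorphic_on upper_half_plane \<and>
     (\<forall>A\<in>Gamma0 N. \<forall>z\<in>upper_half_plane. slash k A f z = f z) \<and>
     (\<forall>s. meromorphic_at_cusp k f s)"

definition M_space :: "nat \<Rightarrow> int \<Rightarrow> (complex \<Rightarrow> complex) set" where
  "M_space N k = {f. weakly_holomorphic_form N k f \<and> (\<forall>s. holomorphic_at_cusp k f s)}"

definition R_space :: "nat \<Rightarrow> int \<Rightarrow> (complex \<Rightarrow> complex) set" where
  "R_space N k = {f. weakly_holomorphic_form N k f \<and>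
     (\<forall>s. \<not> cusp_equiv N s None \<longrightarrow> holomorphic_at_cusp k f s)}"

definition dedekind_eta :: "complex \<Rightarrow> complex" where
  "dedekind_eta z = exp (2 * of_real pi * \<i> * z / 24) *
     (\<Prod>n. 1 - exp (2 * of_real pi * \<i> * z) ^ Suc n)"

definition eta_quotient :: "nat \<Rightarrow> (nat \<Rightarrow> int) \<Rightarrow> complex \<Rightarrow> complex" where
  "eta_quotient N r z =
     (if z \<in> upper_half_plane
      then \<Prod>\<delta> | \<delta> dvd N. dedekind_eta (of_nat \<delta> * z) powi r \<delta> else 0)"

interpretation cfun: vector_space "\<lambda>(c::complex) (f::complex \<Rightarrow> complex) z. c * f z"
  by unfold_locales (auto simp: fun_eq_iff algebra_simps)

definition E_space :: "nat \<Rightarrow> int \<Rightarrow> (complex \<Rightarrow> complex) set" where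
  "E_space N k = cfun.span (R_space N k \<inter> range (eta_quotient N))"

end

theory Submission
  imports Defs
begin

text \<open>
  Eta-quotients have no zeros in the upper half plane, so a form may be divided by one as soon as its
  orders at the cusps are under control. For every \<open>N\<close> there is an eta-quotient \<open>F\<close> of level
  \<open>N\<close>, of positive even weight \<open>w\<close>, whose zeros all lie at infinity (\<open>good_exponents_exist\<close>).
  Multiplication by a power of \<open>F\<close>, positive or negative, shifts the weight of the spaces R and
  carries combinations of eta-quotients to combinations of eta-quotients.

  A form \<open>f\<close> in R has a pole at infinity only, which a high power of \<open>F\<close> clears. If the
  spaces M of positive even weight are spanned by eta-quotients, then \<open>F ^ j * f\<close> is a combination of
  eta-quotients and hence so is \<open>f\<close> (\<open>R_space_subset_E_space_if_M_space\<close>).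

  Now let the space R of weight 2 be spanned by eta-quotients. It is enough to find, for some
  eta-quotient \<open>e\<close> of weight 2 in R, an identity \<open>1 = e * v1 + u * v2\<close> with \<open>u\<close> in R of weight
  2 and \<open>v1\<close>, \<open>v2\<close> in R of weight -2: then \<open>f = e * (v1 * f) + u * (v2 * f)\<close>
  reduces the weight of \<open>f\<close> by 2, and weight 0 is reached from weight \<open>w\<close> by division by
  \<open>F\<close>. The space R of weight 0 is the coordinate ring of the affine modular curve without the cusp infinity,
  the products of weight 2 by weight -2 span an ideal in it, and the identity says that this ideal has
  no zero on the curve (\<open>unit_ideal_from_eta_quotient\<close>). In the upper half
  plane \<open>e\<close> has no zeros. At the cusps other than infinity, \<open>F\<close> has order 0 and \<open>Delta = eta ^ 24\<close>
  has positive order, so the logarithmic derivative \<open>u\<close> of \<open>F / Delta ^ t\<close>, where \<open>w = 12 * t\<close>, is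
  a form of weight 2 that does not vanish there. Then \<open>p = u ^ (6 * t) / F\<close> is in the ideal and takes
  finitely many values \<open>v\<close> at these cusps, all different from 0. For \<open>Q = \<Prod>(X - v)\<close> the function
  \<open>Q(p)\<close> vanishes at these cusps; some power of it is therefore divisible by \<open>e\<close> and lies in the ideal.
  But it is congruent to a power of \<open>Q(0)\<close>, a nonzero constant, modulo \<open>p\<close>.

  If R of weight 2 is spanned by eta-quotients but contains none of them, it is zero. The form
  \<open>u\<close> excludes \<open>N > 1\<close>. For \<open>N = 1\<close> the derivative of a form of weight 0 has weight 2, so
  the forms of weight 0 are the constants; for \<open>f\<close> of weight \<open>2 * l\<close> this makes
  \<open>f ^ 6 / Delta ^ l\<close> constant, and \<open>f\<close> is a multiple of \<open>eta ^ (4 * l)\<close>.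

  All information about cusps comes from the modularity of \<open>Delta\<close>, whose core is
  \<open>Delta (-1/t) = t ^ 12 * Delta t\<close> (\<open>euler_product_transform\<close>). It follows from a theta function
  \<open>\<theta>\<^sub>t\<close> that is determined by its two quasi-periods 1 and \<open>t\<close> and its zero at 0, up to a constant
  factor. So \<open>\<theta>\<close> for \<open>-1/t\<close> is \<open>\<theta>\<close> for \<open>t\<close> up to a factor \<open>C\<close>
  and an exponential. The derivatives at 0 express \<open>C\<close> through the Euler products at \<open>t\<close> and
  \<open>-1/t\<close>, while the product of the three values at the half periods is elementary and yields
  \<open>C ^ 3\<close>.
\<close>

(* Coefficients of formal power series use the same infix sign as entries of matrices. *)
no_notation fps_nth (infixl \<open>$\<close> 75)

section \<open>Infinite products in the nome\<close>

text \<open>The q-Pochhammer symbol \<open>(x; q)\<close> with infinitely many factors.\<close>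

definition qpoch :: "complex \<Rightarrow> complex \<Rightarrow> complex" where
  "qpoch x q = (\<Prod>n. 1 - x * q ^ n)"

lemma qpoch_has_prod:
  assumes "norm q < 1"
  shows "(\<lambda>n. 1 - x * q ^ n) has_prod qpoch x q"
proof -
  have "summable (\<lambda>n. norm (1 - x * q ^ n - 1))"
    using assms by (auto simp: norm_mult norm_power intro!: summable_mult summable_geometric)
  then have "convergent_prod (\<lambda>n. 1 - x * q ^ n)"
    by (intro abs_convergent_prod_imp_convergent_prod summable_imp_abs_convergent_prod)
  then show ?thesis unfolding qpoch_def by (rule convergent_prod_has_prod)
qed

lemma qpoch_LIMSEQ:
  assumes "norm q < 1"
  shows "(\<lambda>n. \<Prod>k<n. 1 - x * q ^ k) \<longlonglongrightarrow> qpoch x q"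
  using qpoch_has_prod[OF assms] by (rule has_prod_imp_tendsto')

lemma qpoch_eq_0_iff:
  assumes "norm q < 1"
  shows "qpoch x q = 0 \<longleftrightarrow> (\<exists>n. x * q ^ n = 1)"
proof -
  have "qpoch x q = 0 \<longleftrightarrow> 0 \<in> range (\<lambda>n. 1 - x * q ^ n)"
    by (rule has_prod_eq_0_iff[OF qpoch_has_prod[OF assms]])
  also have "\<dots> \<longleftrightarrow> (\<exists>n. x * q ^ n = 1)"
    by (metis (no_types, lifting) eq_iff_diff_eq_0 rangeE rangeI)
  finally show ?thesis .
qed

lemma qpoch_step:
  assumes "norm q < 1"
  shows "qpoch x q = (1 - x) * qpoch (x * q) q"
proof (rule LIMSEQ_unique)
  show "(\<lambda>n. \<Prod>k<Suc n. 1 - x * q ^ k) \<longlonglongrightarrow> qpoch x q"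
    using qpoch_LIMSEQ[OF assms] by (rule LIMSEQ_Suc)
  have "(\<Prod>k<Suc n. 1 - x * q ^ k) = (1 - x) * (\<Prod>k<n. 1 - (x * q) * q ^ k)" for n
    by (subst prod.lessThan_Suc_shift) (simp add: mult_ac)
  then show "(\<lambda>n. \<Prod>k<Suc n. 1 - x * q ^ k) \<longlonglongrightarrow> (1 - x) * qpoch (x * q) q"
    using tendsto_mult_left[OF qpoch_LIMSEQ[OF assms, of "x * q"], of "1 - x"] by simp
qed

text \<open>Splits the product into its factors of even and of odd index.\<close>

lemma qpoch_double:
  assumes "norm q < 1"
  shows "qpoch x q = qpoch x (q\<^sup>2) * qpoch (x * q) (q\<^sup>2)"
proof (rule LIMSEQ_unique)
  have q2: "norm (q\<^sup>2) < 1"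
    using assms by (simp add: norm_power power_less_one_iff)
  have "(\<Prod>k<2*n. 1 - x * q ^ k) = (\<Prod>k<n. 1 - x * (q\<^sup>2) ^ k) * (\<Prod>k<n. 1 - x * q * (q\<^sup>2) ^ k)" for n
    by (induction n) (simp_all add: mult_ac flip: power_mult)
  then show "(\<lambda>n. \<Prod>k<2*n. 1 - x * q ^ k) \<longlonglongrightarrow> qpoch x (q\<^sup>2) * qpoch (x * q) (q\<^sup>2)"
    using tendsto_mult[OF qpoch_LIMSEQ[OF q2, of x] qpoch_LIMSEQ[OF q2, of "x * q"]] by simp
  show "(\<lambda>n. \<Prod>k<2*n. 1 - x * q ^ k) \<longlonglongrightarrow> qpoch x q"
    by (rule filterlim_compose[OF qpoch_LIMSEQ[OF assms]])
       (simp add: filterlim_subseq strict_mono_def)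
qed

lemma qpoch_mult_minus:
  assumes "norm q < 1"
  shows "qpoch x q * qpoch (-x) q = qpoch (x\<^sup>2) (q\<^sup>2)"
proof (rule LIMSEQ_unique)
  have q2: "norm (q\<^sup>2) < 1"
    using assms by (simp add: norm_power power_less_one_iff)
  show "(\<lambda>n. \<Prod>k<n. 1 - x\<^sup>2 * (q\<^sup>2) ^ k) \<longlonglongrightarrow> qpoch (x\<^sup>2) (q\<^sup>2)"
    by (rule qpoch_LIMSEQ[OF q2])
  have "(\<Prod>k<n. 1 - x * q ^ k) * (\<Prod>k<n. 1 - (-x) * q ^ k) = (\<Prod>k<n. 1 - x\<^sup>2 * (q\<^sup>2) ^ k)" for n
    unfolding prod.distrib[symmetric]
    by (intro prod.cong) (auto simp: algebra_simps power2_eq_square power_mult_distrib)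
  then show "(\<lambda>n. \<Prod>k<n. 1 - x\<^sup>2 * (q\<^sup>2) ^ k) \<longlonglongrightarrow> qpoch x q * qpoch (-x) q"
    using tendsto_mult[OF qpoch_LIMSEQ[OF assms, of x] qpoch_LIMSEQ[OF assms, of "-x"]] by simp
qed

lemma qpoch_self_nonzero:
  assumes "norm q < 1" shows "qpoch q q \<noteq> 0"
proof
  assume "qpoch q q = 0"
  then obtain n where "q * q ^ n = 1" using qpoch_eq_0_iff[OF assms] by blast
  then have "norm q ^ Suc n = 1" by (metis norm_one norm_power power_Suc)
  moreover have "norm q ^ Suc n \<le> norm q ^ 1"
    using assms by (intro power_decreasing) auto
  ultimately show False using assms by simp
qed

text \<open>Euler's identity between partitions into distinct and into odd parts, for \<open>q = s\<^sup>2\<close> and with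
  the odd product split once more by \<open>1 - s\<^sup>2 x\<^sup>2 = (1 - s x) (1 + s x)\<close>. It is what makes the product of
  the theta values at the half periods elementary.\<close>

lemma euler_odd_distinct:
  assumes "norm s < 1"
  shows "qpoch (-(s\<^sup>2)) (s\<^sup>2) * qpoch s (s\<^sup>2) * qpoch (-s) (s\<^sup>2) = 1"
proof -
  define q where "q = s\<^sup>2"
  have q: "norm q < 1" and q2: "norm (q\<^sup>2) < 1"
    using assms by (simp_all add: q_def norm_power power_less_one_iff)
  have nz: "qpoch (q\<^sup>2) (q\<^sup>2) \<noteq> 0" by (rule qpoch_self_nonzero[OF q2])
  have "qpoch q q * qpoch (-q) q = qpoch (q\<^sup>2) (q\<^sup>2)" by (rule qpoch_mult_minus[OF q])
  moreover have "qpoch q q = qpoch q (q\<^sup>2) * qpoch (q\<^sup>2) (q\<^sup>2)"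
    using qpoch_double[OF q, of q] by (simp add: power2_eq_square)
  moreover have "qpoch s q * qpoch (-s) q = qpoch q (q\<^sup>2)"
    using qpoch_mult_minus[OF q, of s] by (simp add: q_def)
  ultimately have "qpoch (-q) q * (qpoch s q * qpoch (-s) q) = 1"
    using nz by (simp add: mult_ac)
  then show ?thesis unfolding q_def[symmetric] by (simp add: mult.assoc)
qed

text \<open>Both arguments may vary: the theta function needs a fixed \<open>q\<close>, and the Euler product needs
  \<open>x = q\<close>.\<close>

lemma qpoch_holomorphic:
  assumes f: "f holomorphic_on A" and g: "g holomorphic_on A" and A: "open A"
    and lt: "\<And>z. z \<in> A \<Longrightarrow> norm (g z) < 1"
  shows "(\<lambda>z. qpoch (f z) (g z)) holomorphic_on A"
proof (rule holomorphic_uniform_sequence[where f = "\<lambda>n z. \<Prod>k<n. 1 - f z * g z ^ k"])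
  show "open A" by fact
  show "(\<lambda>z. \<Prod>k<n. 1 - f z * g z ^ k) holomorphic_on A" for n
    by (intro holomorphic_intros f g)
  fix z assume "z \<in> A"
  then obtain d where d: "d > 0" "cball z d \<subseteq> A" using A open_contains_cball by blast
  define K where "K = cball z d"
  have K: "compact K" "K \<noteq> {}" "K \<subseteq> A" using d by (auto simp: K_def)
  have cf: "continuous_on K f" and cg: "continuous_on K g"
    using f g K holomorphic_on_imp_continuous_on continuous_on_subset by blast+
  obtain B where B: "\<And>w. w \<in> K \<Longrightarrow> norm (f w) \<le> B"
    using compact_continuous_image[OF cf K(1)] compact_imp_bounded bounded_iff
    by (metis imageI)
  obtain w0 where w0: "w0 \<in> K" "\<And>w. w \<in> K \<Longrightarrow> norm (g w) \<le> norm (g w0)"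
    using continuous_attains_sup[of K "\<lambda>w. norm (g w)"] K cg continuous_on_norm by blast
  define r where "r = norm (g w0)"
  have r: "0 \<le> r" "r < 1" using lt w0 K by (auto simp: r_def)
  have "uniformly_convergent_on K (\<lambda>n z. \<Prod>k<n. 1 - f z * g z ^ k)"
  proof (rule uniformly_convergent_on_prod')
    show "uniformly_convergent_on K (\<lambda>n z. \<Sum>k<n. norm (1 - f z * g z ^ k - 1))"
    proof (rule Weierstrass_m_test')
      fix n w assume w: "w \<in> K"
      have "norm (f w) * norm (g w) ^ n \<le> B * r ^ n"
        using B[OF w] w0(2)[OF w] by (intro mult_mono power_mono) (auto simp: r_def intro: order_trans[OF norm_ge_zero])
      then show "norm (norm (1 - f w * g w ^ n - 1)) \<le> B * r ^ n"
        by (simp add: norm_mult norm_power)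
    qed (use r in \<open>auto intro!: summable_mult summable_geometric\<close>)
  qed (use K cf cg in \<open>auto intro!: continuous_intros\<close>)
  then obtain l where l: "uniform_limit K (\<lambda>n z. \<Prod>k<n. 1 - f z * g z ^ k) l sequentially"
    by (auto simp: uniformly_convergent_on_def)
  have "l w = qpoch (f w) (g w)" if "w \<in> K" for w
    using tendsto_uniform_limitI[OF l that] qpoch_LIMSEQ[of "g w" "f w"] lt that K LIMSEQ_unique by blast
  then have "uniform_limit K (\<lambda>n z. \<Prod>k<n. 1 - f z * g z ^ k) (\<lambda>z. qpoch (f z) (g z)) sequentially"
    using l uniform_limit_cong' by (metis (no_types, lifting))
  then show "\<exists>d>0. cball z d \<subseteq> A \<and>
      uniform_limit (cball z d) (\<lambda>n z. \<Prod>k<n. 1 - f z * g z ^ k) (\<lambda>z. qpoch (f z) (g z)) sequentially"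
    using d K_def by blast
qed

definition nome :: "complex \<Rightarrow> complex" where
  "nome z = exp (2 * of_real pi * \<i> * z)"

lemma nome_nonzero [simp]: "nome z \<noteq> 0" by (simp add: nome_def)

lemma norm_nome_less_1: "Im z > 0 \<Longrightarrow> norm (nome z) < 1"
  by (simp add: nome_def norm_exp_eq_Re)

lemma nome_add: "nome (z + w) = nome z * nome w"
  by (simp add: nome_def exp_add distrib_left)

lemma nome_minus: "nome (- z) = inverse (nome z)"
  by (simp add: nome_def exp_minus)

lemma nome_of_int [simp]: "nome (of_int n) = 1"
  by (simp add: nome_def exp_eq_1) 

lemma nome_0 [simp]: "nome 0 = 1"
  by (simp add: nome_def)

lemma nome_1 [simp]: "nome 1 = 1"
  using nome_of_int[of 1] by simp

lemma nome_power: "nome z ^ n = nome (of_nat n * z)"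
  by (simp add: nome_def exp_of_nat_mult[symmetric] mult_ac)

lemma nome_holomorphic [holomorphic_intros]:
  "f holomorphic_on A \<Longrightarrow> (\<lambda>z. nome (f z)) holomorphic_on A"
  unfolding nome_def by (intro holomorphic_intros)

lemma nome_eq_1_iff: "nome z = 1 \<longleftrightarrow> z \<in> \<int>"
proof
  assume "nome z = 1"
  then obtain n :: int where "Re (2 * of_real pi * \<i> * z) = 0" "Im (2 * of_real pi * \<i> * z) = of_int (2 * n) * pi"
    unfolding nome_def exp_eq_1 by blast
  then have "z = of_int n" by (auto simp: complex_eq_iff)
  then show "z \<in> \<int>" by simp
qed (auto elim!: Ints_cases)

section \<open>A theta function and its inversion formula\<close>

text \<open>By the Jacobi triple product this is Jacobi's first theta function, up to a factor that does not
  depend on \<open>v\<close>. With this normalization the product of the values at the half periods contains no infinite product.\<close>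

definition jtheta :: "complex \<Rightarrow> complex \<Rightarrow> complex" where
  "jtheta t v = nome (- v / 2) * qpoch (nome v) (nome t) * qpoch (nome t / nome v) (nome t)"

lemma nome_half [simp]: "nome (1/2) = -1"
  using exp_pi_i' by (simp add: nome_def)

lemma jtheta_add_1:
  "jtheta t (v + 1) = - jtheta t v"
proof -
  have "nome (- (v + 1) / 2) = nome (- v / 2) * nome (- (1/2))"
    unfolding nome_add[symmetric] by (simp add: field_simps)
  also have "\<dots> = - nome (- v / 2)" by (simp only: nome_minus nome_half) simp
  finally show ?thesis
    by (simp add: jtheta_def nome_add)
qed

lemma jtheta_odd:
  assumes "Im t > 0"
  shows "jtheta t (- v) = - jtheta t v"
proof -
  define x where "x = nome (v/2)"
  have x: "x \<noteq> 0" "nome v = x^2" by (simp_all add: x_def nome_power)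
  define a b where "a = qpoch (x\<^sup>2 * nome t) (nome t)" and "b = qpoch (nome t / x\<^sup>2) (nome t)"
  have 1: "qpoch (x\<^sup>2) (nome t) = (1 - x\<^sup>2) * a"
    and 2: "qpoch (1 / x\<^sup>2) (nome t) = (1 - 1 / x\<^sup>2) * b"
    using qpoch_step[OF norm_nome_less_1[OF assms], of "x\<^sup>2"]
      qpoch_step[OF norm_nome_less_1[OF assms], of "1 / x\<^sup>2"] by (simp_all add: a_def b_def)
  have nm: "nome (- v / 2) = 1 / x"
    using nome_minus[of "v/2"] by (simp add: x_def inverse_eq_divide)
  have "jtheta t v = (1 / x) * ((1 - x\<^sup>2) * a) * b"
    unfolding jtheta_def nm x(2) 1 b_def by simp
  moreover have "jtheta t (- v) = x * ((1 - 1 / x\<^sup>2) * b) * a"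
    unfolding jtheta_def nome_minus x(2) 2[symmetric] a_def
    by (simp add: x_def inverse_eq_divide mult_ac)
  moreover have "(1 / x) * ((1 - x\<^sup>2) * a) * b = - (x * ((1 - 1 / x\<^sup>2) * b) * a)"
    using x(1) by (simp add: divide_simps power2_eq_square) (simp add: algebra_simps)
  ultimately show ?thesis by simp
qed

lemma jtheta_add_t:
  assumes "Im t > 0"
  shows "jtheta t (v + t) = - nome (- t / 2 - v) * jtheta t v"
proof -
  have 1: "qpoch (nome v) (nome t) = (1 - nome v) * qpoch (nome v * nome t) (nome t)"
    by (rule qpoch_step[OF norm_nome_less_1[OF assms]])
  have 2: "qpoch (1 / nome v) (nome t) = (1 - 1 / nome v) * qpoch (nome t / nome v) (nome t)"
    using qpoch_step[OF norm_nome_less_1[OF assms], of "1 / nome v"] by simp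
  have 3: "nome (- (v + t) / 2) = nome (- v / 2) * nome (- t / 2)"
    unfolding nome_add[symmetric] by (simp add: field_simps)
  have 4: "nome (- t / 2 - v) = nome (- t / 2) / nome v"
    using nome_add[of "- t / 2" "- v"] by (metis diff_conv_add_uminus divide_inverse nome_minus)
  have 5: "nome t / (nome v * nome t) = 1 / nome v"
    by simp
  have alg: "A * B * Qa * ((1 - 1 / x) * Qb) = - (B / x) * (A * ((1 - x) * Qa) * Qb)"
    if "x \<noteq> 0" for A B Qa Qb x :: complex
    using that by (simp add: field_simps)
  show ?thesis
    unfolding jtheta_def nome_add 3 4 5 1 2 by (rule alg) simp
qed

lemma jtheta_holomorphic:
  assumes "Im t > 0"
  shows "jtheta t holomorphic_on A"
proof -
  have "jtheta t holomorphic_on UNIV"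
    unfolding jtheta_def[abs_def] using norm_nome_less_1[OF assms]
    by (intro holomorphic_intros qpoch_holomorphic) auto
  then show ?thesis by (rule holomorphic_on_subset) auto
qed

lemma jtheta_eq_0_iff:
  assumes "Im t > 0"
  shows "jtheta t v = 0 \<longleftrightarrow> (\<exists>m n. v = of_int m + of_int n * t)"
proof -
  have q: "norm (nome t) < 1" by (rule norm_nome_less_1[OF assms])
  have eq: "nome v * nome t ^ n = nome (v + of_nat n * t)"
    "nome t / nome v * nome t ^ n = nome (of_nat (Suc n) * t - v)" for n
    using nome_add[of "of_nat (Suc n) * t" "-v"]
    by (simp_all add: nome_add nome_power nome_minus field_simps)
  have "jtheta t v = 0 \<longleftrightarrow> (\<exists>n::nat. v + of_nat n * t \<in> \<int>) \<or> (\<exists>n::nat. of_nat (Suc n) * t - v \<in> \<int>)"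
    unfolding jtheta_def mult_eq_0_iff qpoch_eq_0_iff[OF q] eq nome_eq_1_iff by simp
  also have "\<dots> \<longleftrightarrow> (\<exists>m n. v = of_int m + of_int n * t)"
  proof (intro iffI; (elim disjE exE)?)
    fix n assume "v + of_nat n * t \<in> \<int>"
    then obtain m where "v + of_nat n * t = of_int m" by (auto elim: Ints_cases)
    then have "v = of_int m + of_int (- int n) * t" by (simp add: algebra_simps)
    then show "\<exists>m n. v = of_int m + of_int n * t" by blast
  next
    fix n assume "of_nat (Suc n) * t - v \<in> \<int>"
    then obtain m where "of_nat (Suc n) * t - v = of_int m" by (auto elim: Ints_cases)
    then have "v = of_int (-m) + of_int (int (Suc n)) * t" by (simp add: algebra_simps)
    then show "\<exists>m n. v = of_int m + of_int n * t" by blast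
  next
    fix m n assume v: "v = of_int m + of_int n * t"
    show "(\<exists>n::nat. v + of_nat n * t \<in> \<int>) \<or> (\<exists>n::nat. of_nat (Suc n) * t - v \<in> \<int>)"
    proof (cases "n \<le> 0")
      case True
      then have "v + of_nat (nat (-n)) * t = of_int m" by (simp add: v algebra_simps)
      then show ?thesis by (metis Ints_of_int)
    next
      case False
      then have "of_nat (Suc (nat (n - 1))) * t - v = of_int (-m)" by (simp add: v algebra_simps)
      then show ?thesis by (metis Ints_of_int)
    qed
  qed
  finally show ?thesis .
qed

lemma jtheta_deriv_0:
  assumes "Im t > 0"
  shows "(jtheta t has_field_derivative (- 2 * of_real pi * \<i> * qpoch (nome t) (nome t) ^ 2)) (at 0)"
proof -
  define K where "K v = qpoch (nome v * nome t) (nome t) * qpoch (nome t / nome v) (nome t)" for v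
  have q: "norm (nome t) < 1" by (rule norm_nome_less_1[OF assms])
  have eq: "jtheta t = (\<lambda>v. (nome (- v / 2) - nome (v / 2)) * K v)"
  proof
    fix v
    have "nome v = nome (v/2) ^ 2" by (simp add: nome_power)
    then have "nome (- v / 2) * (1 - nome v) = nome (- v / 2) - nome (v / 2)"
      using nome_minus[of "v/2"] by (simp add: field_simps power2_eq_square)
    then show "jtheta t v = (nome (- v / 2) - nome (v / 2)) * K v"
      by (simp add: jtheta_def K_def qpoch_step[OF q, of "nome v"] mult.assoc[symmetric])
  qed
  have "K holomorphic_on UNIV" unfolding K_def[abs_def] using q
    by (intro holomorphic_intros qpoch_holomorphic) auto
  then obtain k where k: "(K has_field_derivative k) (at 0)"
    using holomorphic_derivI[of K UNIV 0] by auto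
  have "K 0 = qpoch (nome t) (nome t) ^ 2" by (simp add: K_def power2_eq_square nome_def)
  moreover have "((\<lambda>v. nome (- v / 2) - nome (v / 2)) has_field_derivative (- 2 * of_real pi * \<i>)) (at 0)"
    unfolding nome_def by (auto intro!: derivative_eq_intros)
  ultimately show ?thesis unfolding eq
    using DERIV_mult[OF _ k, of "\<lambda>v. nome (- v / 2) - nome (v / 2)" "- 2 * of_real pi * \<i>"]
    by (simp add: nome_def)
qed


lemma periodic_int:
  fixes g :: "complex \<Rightarrow> 'b"
  assumes "\<And>v. g (v + a) = g v"
  shows "g (v + of_int n * a) = g v"
proof (induction n rule: int_induct[where k = 0])
  case (step1 i)
  then show ?case using assms[of "v + of_int i * a"] by (simp add: algebra_simps)
next
  case (step2 i)
  then show ?case using assms[of "v + of_int (i - 1) * a"] by (simp add: algebra_simps)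
qed auto

text \<open>Liouville's theorem for \<open>f / jtheta t\<close>. The quotient is doubly periodic, and the zeros of the
  denominator are the translates of the simple zero at 0, where \<open>f\<close> vanishes too; so all singularities are
  removable, and the values are those on a compact period parallelogram.\<close>

lemma jtheta_unique:
  assumes t: "Im t > 0" and hol: "f holomorphic_on UNIV" and f0: "f 0 = 0"
    and f1: "\<And>v. f (v + 1) = - f v"
    and ft: "\<And>v. f (v + t) = - nome (- t / 2 - v) * f v"
  obtains C where "\<And>v. f v = C * jtheta t v"
proof -
  define r where "r v = f v / jtheta t v" for v
  define h where "h = remove_sings r"
  have r1: "r (v + 1) = r v" for v
    by (simp add: r_def f1 jtheta_add_1)
  have rt: "r (v + t) = r v" for v
    by (simp add: r_def ft jtheta_add_t[OF t])
  have per: "r (v + (of_int m + of_int n * t)) = r v" for v m n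
    using periodic_int[of r 1 "v + of_int n * t" m, OF r1] periodic_int[of r t v n, OF rt]
    by (simp add: algebra_simps)
  have h_per: "h (v + (of_int m + of_int n * t)) = h v" for v m n
  proof -
    have "h (v + (of_int m + of_int n * t)) = remove_sings (\<lambda>w. r (v + (of_int m + of_int n * t) + w)) 0"
      unfolding h_def by (rule remove_sings_shift_0)
    also have "(\<lambda>w. r (v + (of_int m + of_int n * t) + w)) = (\<lambda>w. r (v + w))"
      using per[of "v + w" m n for w] by (simp add: algebra_simps)
    also have "remove_sings \<dots> 0 = h v" unfolding h_def by (rule remove_sings_shift_0[symmetric])
    finally show ?thesis .
  qed
  have an: "f analytic_on UNIV" "jtheta t analytic_on UNIV"
    using hol jtheta_holomorphic[OF t] by (simp_all add: analytic_on_open)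
  have "r meromorphic_on UNIV"
    unfolding r_def[abs_def] using an
    by (intro meromorphic_on_divide analytic_on_imp_meromorphic_on) auto
  then have iso: "isolated_singularity_at r z" for z
    by (simp add: meromorphic_on_altdef)
  obtain f' where f': "(f has_field_derivative f') (at 0)"
    using holomorphic_derivI[OF hol] by auto
  define c where "c = f' / (- 2 * of_real pi * \<i> * qpoch (nome t) (nome t) ^ 2)"
  have lim0: "r \<midarrow>0\<rightarrow> c"
    unfolding r_def[abs_def] c_def
    by (rule lhopital_complex_simple[OF f' jtheta_deriv_0[OF t]])
       (use f0 t jtheta_eq_0_iff[OF t, of 0] qpoch_self_nonzero[OF norm_nome_less_1[OF t]]
         in \<open>auto intro: exI[of _ 0]\<close>)
  have h_an: "h analytic_on {v}" for v
  proof (cases "jtheta t v = 0")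
    case False
    have "r analytic_on {v}" unfolding r_def[abs_def]
      using False an by (intro analytic_on_divide) (auto intro: analytic_on_subset)
    then show ?thesis unfolding h_def by (rule remove_sings_analytic_on)
  next
    case True
    then obtain m n where v: "v = of_int m + of_int n * t" using jtheta_eq_0_iff[OF t] by blast
    have "r (x + - v) = r x" for x using per[of "x - v" m n, folded v] by simp
    then have "r \<midarrow>v\<rightarrow> c" using LIM_offset[OF lim0, of "- v"] by simp
    then show ?thesis unfolding h_def by (rule remove_sings_analytic_at[OF iso])
  qed
  then have h_hol: "h holomorphic_on UNIV"
    using analytic_imp_holomorphic analytic_on_analytic_at by blast
  define K where "K = (\<lambda>(x, y). of_real x + of_real y * t) ` ({0..1::real} \<times> {0..1::real})"
  have "compact K" unfolding K_def
    by (intro compact_continuous_image compact_Times)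
       (auto simp: case_prod_unfold intro!: continuous_intros)
  then have "bounded (h ` K)"
    by (intro compact_imp_bounded compact_continuous_image
        holomorphic_on_imp_continuous_on holomorphic_on_subset[OF h_hol]) auto
  moreover have "range h \<subseteq> h ` K"
  proof safe
    fix v
    define y where "y = Im v / Im t"
    define x where "x = Re v - y * Re t"
    have v: "v = of_real x + of_real y * t"
      using t by (simp add: complex_eq_iff x_def y_def)
    have "v = (of_real (frac x) + of_real (frac y) * t) + (of_int \<lfloor>x\<rfloor> + of_int \<lfloor>y\<rfloor> * t)"
      unfolding v by (simp add: frac_def algebra_simps)
    then have "h v = h (of_real (frac x) + of_real (frac y) * t)"
      using h_per by metis
    moreover have "of_real (frac x) + of_real (frac y) * t \<in> K"
      unfolding K_def by (rule image_eqI[of _ _ "(frac x, frac y)"]) (auto simp: frac_lt_1 less_imp_le)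
    ultimately show "h v \<in> h ` K" by blast
  qed
  ultimately have "bounded (range h)" by (rule bounded_subset)
  then obtain C where C: "\<And>v. h v = C"
    using Liouville_theorem[OF h_hol] by (auto simp: constant_on_def)
  have "f v = C * jtheta t v" for v
  proof (cases "jtheta t v = 0")
    case False
    have "r analytic_on {v}" unfolding r_def[abs_def]
      using False an by (intro analytic_on_divide) (auto intro: analytic_on_subset)
    then have "h v = r v" unfolding h_def by (rule remove_sings_at_analytic)
    then show ?thesis using C[of v] False by (simp add: r_def)
  next
    case True
    then obtain m n where v: "v = of_int m + of_int n * t" using jtheta_eq_0_iff[OF t] by blast
    define Z where "Z v \<longleftrightarrow> f v = 0" for v
    have "Z (0 + of_int n * t + of_int m * 1) = Z 0"
      using periodic_int[of Z 1 "0 + of_int n * t" m] periodic_int[of Z t 0 n]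
      by (simp add: Z_def f1 ft)
    then show ?thesis using True f0 by (simp add: Z_def v add.commute)
  qed
  then show thesis using that by blast
qed

text \<open>The exponential factor is chosen such that \<open>jtheta (-1/t) (v / t)\<close> divided by it has the
  quasi-periods of \<open>jtheta t\<close>; the translations by 1 and by the period exchange their roles.\<close>

lemma jtheta_transform:
  assumes t: "Im t > 0"
  obtains C where "\<And>v. jtheta (-1/t) (v / t) = C * nome (v\<^sup>2 / (2*t)) * jtheta t v"
proof -
  define t' where "t' = -1/t"
  have t0: "t \<noteq> 0" using t by auto
  have t': "Im t' > 0"
    using t by (simp add: t'_def Im_divide power2_eq_square add_nonneg_pos)
  define f where "f v = jtheta t' (v / t) * nome (- v\<^sup>2 / (2*t))" for v
  have hol: "f holomorphic_on UNIV"
  proof -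
    have "(\<lambda>v. jtheta t' (v / t)) holomorphic_on UNIV"
      using t0 by (intro holomorphic_on_compose_gen[of "\<lambda>v. v / t" UNIV "jtheta t'" UNIV, unfolded o_def]
          jtheta_holomorphic[OF t'] holomorphic_intros) auto
    then show ?thesis unfolding f_def[abs_def] using t0 by (intro holomorphic_intros) auto
  qed
  have f0: "f 0 = 0"
    using jtheta_eq_0_iff[OF t', of 0] by (auto simp: f_def intro: exI[of _ 0])
  have ft: "f (v + t) = - nome (- t / 2 - v) * f v" for v
  proof -
    have "- (v + t)\<^sup>2 / (2*t) = - v\<^sup>2 / (2*t) + (- t / 2 - v)"
      using t0 by (simp add: field_simps power2_eq_square)
    then have "nome (- (v + t)\<^sup>2 / (2*t)) = nome (- v\<^sup>2 / (2*t)) * nome (- t / 2 - v)"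
      using nome_add by metis
    moreover have "(v + t) / t = v / t + 1" using t0 by (simp add: field_simps)
    ultimately show ?thesis by (simp add: f_def jtheta_add_1)
  qed
  have f1: "f (v + 1) = - f v" for v
  proof -
    have "(v + 1) / t + t' = v / t" using t0 by (simp add: t'_def field_simps)
    then have "jtheta t' (v / t) = - nome (- t' / 2 - (v + 1) / t) * jtheta t' ((v + 1) / t)"
      using jtheta_add_t[OF t', of "(v + 1) / t"] by simp
    moreover have "nome (- v\<^sup>2 / (2*t)) * nome (- t' / 2 - (v + 1) / t) = nome (- (v + 1)\<^sup>2 / (2*t))"
      unfolding nome_add[symmetric] using t0
      by (intro arg_cong[of _ _ nome]) (simp add: t'_def field_simps power2_eq_square)
    ultimately show ?thesis by (simp add: f_def mult_ac)
  qed
  obtain C where C: "\<And>v. f v = C * jtheta t v"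
    using jtheta_unique[OF t hol f0 f1 ft] by blast
  have "jtheta (-1/t) (v / t) = C * nome (v\<^sup>2 / (2*t)) * jtheta t v" for v
  proof -
    have "nome (- v\<^sup>2 / (2*t)) * nome (v\<^sup>2 / (2*t)) = 1"
      unfolding nome_add[symmetric] by (simp add: nome_def)
    then have "jtheta t' (v / t) = f v * nome (v\<^sup>2 / (2*t))"
      by (simp add: f_def)
    then show ?thesis using C[of v] by (simp add: t'_def mult_ac)
  qed
  then show thesis using that by blast
qed

lemma jtheta_half_periods:
  assumes t: "Im t > 0"
  shows "jtheta t (1/2) * jtheta t (t/2) * jtheta t (1/2 + t/2) = - 2 * nome (- t / 2)"
proof -
  define s where "s = nome (t/2)"
  have s0: "s \<noteq> 0" by (simp add: s_def)
  have s2: "nome t = s\<^sup>2" by (simp add: s_def nome_power)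
  have s: "norm s < 1" unfolding s_def using t by (intro norm_nome_less_1) auto
  have q: "norm (s\<^sup>2) < 1" using s by (simp add: norm_power power_less_one_iff)
  define i4 where "i4 = nome (-1/4)"
  have i4: "i4 * i4 = -1"
    unfolding i4_def nome_add[symmetric] using nome_minus[of "1/2"] by simp
  define a where "a = nome (- t / 4)"
  have a: "a * a = 1 / s" unfolding a_def nome_add[symmetric]
    using nome_minus[of "t/2"] by (simp add: s_def field_simps)
  have "jtheta t (1/2) = i4 * (qpoch (-1) (s\<^sup>2) * qpoch (- (s\<^sup>2)) (s\<^sup>2))"
    by (simp add: jtheta_def i4_def s2)
  also have "qpoch (-1) (s\<^sup>2) = 2 * qpoch (- (s\<^sup>2)) (s\<^sup>2)"
    using qpoch_step[OF q, of "-1"] by simp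
  finally have 1: "jtheta t (1/2) = 2 * i4 * (qpoch (- (s\<^sup>2)) (s\<^sup>2))\<^sup>2"
    by (simp add: power2_eq_square)
  have 2: "jtheta t (t/2) = a * (qpoch s (s\<^sup>2))\<^sup>2"
    using s0 by (simp add: jtheta_def a_def s2 flip: s_def) (simp add: power2_eq_square)
  have "nome (1/2 + t/2) = - s" by (simp add: nome_add s_def)
  moreover have "nome (- (1/2 + t/2) / 2) = i4 * a"
    unfolding i4_def a_def nome_add[symmetric]
    by (intro arg_cong[of _ _ nome]) (simp add: field_simps)
  ultimately have 3: "jtheta t (1/2 + t/2) = i4 * a * (qpoch (-s) (s\<^sup>2))\<^sup>2"
    unfolding jtheta_def s2 using s0 by (simp add: power2_eq_square)
  have "jtheta t (1/2) * jtheta t (t/2) * jtheta t (1/2 + t/2) =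
      2 * (i4 * i4) * (a * a) * (qpoch (- (s\<^sup>2)) (s\<^sup>2) * qpoch s (s\<^sup>2) * qpoch (-s) (s\<^sup>2))\<^sup>2"
    unfolding 1 2 3 by (simp add: power2_eq_square)
  also have "\<dots> = - 2 / s" unfolding euler_odd_distinct[OF s] i4 a by simp
  also have "- 2 / s = - 2 * nome (- t / 2)"
    using nome_minus[of "t/2"] by (simp add: s_def inverse_eq_divide)
  finally show ?thesis .
qed

text \<open>The map \<open>v \<mapsto> v / t\<close> permutes the three half periods up to signs and periods, so the elementary
  product of the half period values determines \<open>C ^ 3\<close>, and with it \<open>C ^ 12\<close>, in the relation
  \<open>P (-1/t) ^ 2 = C * t * P t ^ 2\<close> between the Euler products.\<close>

theorem euler_product_transform:
  assumes t: "Im t > 0"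
  shows "nome (-1/t) * qpoch (nome (-1/t)) (nome (-1/t)) ^ 24 =
         t ^ 12 * (nome t * qpoch (nome t) (nome t) ^ 24)"
proof -
  define t' where "t' = -1/t"
  have t0: "t \<noteq> 0" using t by auto
  have t': "Im t' > 0"
    using t by (simp add: t'_def Im_divide power2_eq_square add_nonneg_pos)
  obtain C where C: "\<And>v. jtheta t' (v / t) = C * nome (v\<^sup>2 / (2*t)) * jtheta t v"
    using jtheta_transform[OF t] unfolding t'_def by blast
  define P where "P z = qpoch (nome z) (nome z)" for z
  have deriv: "P t' ^ 2 = C * t * P t ^ 2"
  proof -
    have "((\<lambda>v. jtheta t' (v / t)) has_field_derivative (- 2 * of_real pi * \<i> * P t' ^ 2) * (1 / t)) (at 0)"
      unfolding P_def
      by (rule DERIV_chain'[where f = "\<lambda>v. v / t" and g = "jtheta t'"])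
         (use jtheta_deriv_0[OF t'] t0 in \<open>auto intro!: derivative_eq_intros\<close>)
    moreover have "((\<lambda>v. C * nome (v\<^sup>2 / (2*t)) * jtheta t v) has_field_derivative
        C * (- 2 * of_real pi * \<i> * P t ^ 2)) (at 0)"
    proof -
      have "((\<lambda>v. C * nome (v\<^sup>2 / (2*t))) has_field_derivative 0) (at 0)"
        unfolding nome_def using t0 by (auto intro!: derivative_eq_intros)
      from DERIV_mult[OF this jtheta_deriv_0[OF t]] show ?thesis
        using jtheta_eq_0_iff[OF t, of 0] by (auto simp: P_def mult_ac intro: exI[of _ 0])
    qed
    ultimately have "(- 2 * of_real pi * \<i> * P t' ^ 2) * (1 / t) = C * (- 2 * of_real pi * \<i> * P t ^ 2)"
      unfolding C by (rule DERIV_unique)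
    then show ?thesis using t0 by (simp add: field_simps)
  qed
  have C3: "nome (- t' / 2) = - (C ^ 3) * nome (1/4 + 1/(4*t) + t/4) * nome (- t / 2)"
  proof -
    have n: "nome (1/(8*t)) * nome (t/8) * nome (1/(8*t) + 1/4 + t/8) = nome (1/4 + 1/(4*t) + t/4)"
      unfolding nome_add[symmetric] using t0 by (intro arg_cong[of _ _ nome]) (simp add: field_simps)
    have 1: "- jtheta t' (t'/2) = C * nome (1/(8*t)) * jtheta t (1/2)"
    proof -
      have "1/2 / t = - (t'/2)" "(1/2)\<^sup>2 / (2*t) = 1/(8*t)"
        by (simp_all add: t'_def power2_eq_square)
      then show ?thesis using C[of "1/2"] jtheta_odd[OF t', of "t'/2"] by simp
    qed
    have 2: "jtheta t' (1/2) = C * nome (t/8) * jtheta t (t/2)"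
      using C[of "t/2"] t0 by (simp add: power2_eq_square)
    \<comment> \<open>the sign from oddness cancels the sign from the period 1\<close>
    have "jtheta t' (- (1/2 + t'/2) + 1) = jtheta t' (1/2 + t'/2)"
      unfolding jtheta_add_1 jtheta_odd[OF t'] by simp
    moreover have "- (1/2 + t'/2) + 1 = (1/2 + t/2) / t"
      using t0 by (simp add: t'_def field_simps)
    moreover have "(1/2 + t/2)\<^sup>2 / (2*t) = 1/(8*t) + 1/4 + t/8"
      using t0 by (simp add: field_simps power2_eq_square)
    ultimately have 3: "jtheta t' (1/2 + t'/2) = C * nome (1/(8*t) + 1/4 + t/8) * jtheta t (1/2 + t/2)"
      using C[of "1/2 + t/2"] by simp
    have "2 * nome (- t' / 2) = (- jtheta t' (t'/2)) * jtheta t' (1/2) * jtheta t' (1/2 + t'/2)"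
      using jtheta_half_periods[OF t'] by (simp add: mult_ac)
    also have "\<dots> = C ^ 3 * (nome (1/(8*t)) * nome (t/8) * nome (1/(8*t) + 1/4 + t/8)) *
        (jtheta t (1/2) * jtheta t (t/2) * jtheta t (1/2 + t/2))"
      unfolding 1 2 3 by (simp add: power3_eq_cube)
    also have "\<dots> = 2 * (- (C ^ 3) * nome (1/4 + 1/(4*t) + t/4) * nome (- t / 2))"
      unfolding n jtheta_half_periods[OF t] by simp
    finally show ?thesis by simp
  qed
  have "nome (- t' / 2) ^ 4 = (C ^ 12) * nome (1/4 + 1/(4*t) + t/4) ^ 4 * nome (- t / 2) ^ 4"
    unfolding C3 by (simp add: power_mult_distrib flip: power_mult)
  then have "nome (-2 * t') = (C ^ 12) * (nome (1 + 1/t + t) * nome (- 2 * t))"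
    unfolding nome_power by (simp add: distrib_left mult.assoc)
  also have "nome (1 + 1/t + t) * nome (- 2 * t) = nome (1 + (- t' - t))"
    unfolding nome_add[symmetric] by (intro arg_cong[of _ _ nome]) (simp add: t'_def)
  also have "\<dots> = nome (- t') / nome t"
    using nome_add[of 1 "- t' - t"] nome_add[of "- t'" "- t"] nome_minus[of t]
    by (simp add: inverse_eq_divide)
  finally have "nome (-2 * t') * nome (t' + t') = (C ^ 12) * (nome (- t') * nome (t' + t')) / nome t"
    by simp
  also have "nome (- t') * nome (t' + t') = nome t'"
    unfolding nome_add[symmetric] by simp
  also have "nome (-2 * t') * nome (t' + t') = 1"
    unfolding nome_add[symmetric] by (simp add: nome_def)
  finally have C12: "(C ^ 12) * nome t' = nome t" by (simp add: field_simps)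
  have "nome t' * P t' ^ 24 = nome t' * (P t' ^ 2) ^ 12" by (simp flip: power_mult)
  also have "\<dots> = ((C ^ 12) * nome t') * t ^ 12 * (P t ^ 2) ^ 12"
    unfolding deriv by (simp add: power_mult_distrib)
  also have "\<dots> = t ^ 12 * (nome t * P t ^ 24)"
    unfolding C12 by (simp flip: power_mult)
  finally show ?thesis by (simp add: P_def t'_def)
qed

section \<open>Modularity of the twenty-fourth power of eta\<close>

lemma dedekind_eta_qpoch: "dedekind_eta z = nome (z / 24) * qpoch (nome z) (nome z)"
  by (simp add: dedekind_eta_def nome_def qpoch_def)

lemma dedekind_eta_nonzero: "Im z > 0 \<Longrightarrow> dedekind_eta z \<noteq> 0"
  by (simp add: dedekind_eta_qpoch qpoch_self_nonzero norm_nome_less_1)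

lemma dedekind_eta_scaled_holomorphic:
  assumes "d > 0"
  shows "(\<lambda>z. dedekind_eta (of_nat d * z)) holomorphic_on upper_half_plane"
  unfolding dedekind_eta_qpoch using assms
  by (intro holomorphic_intros qpoch_holomorphic)
     (auto simp: upper_half_plane_def open_halfspace_Im_gt intro!: norm_nome_less_1)

definition Delta :: "complex \<Rightarrow> complex" where
  "Delta z = dedekind_eta z ^ 24"

lemma Delta_qpoch: "Delta z = nome z * qpoch (nome z) (nome z) ^ 24"
  by (simp add: Delta_def dedekind_eta_qpoch power_mult_distrib nome_power)

lemma Delta_add_int: "Delta (z + of_int n) = Delta z"
  by (simp add: Delta_qpoch nome_add)

lemma Delta_S: "Im z > 0 \<Longrightarrow> Delta (- 1 / z) = z ^ 12 * Delta z"
  unfolding Delta_qpoch by (rule euler_product_transform)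

lemma det_1_automorphy:
  fixes a b c d :: int
  assumes det: "a * d - b * c = 1" and z: "Im z > 0"
  shows "of_int c * z + of_int d \<noteq> 0"
    and "Im ((of_int a * z + of_int b) / (of_int c * z + of_int d)) > 0"
proof -
  show nz: "of_int c * z + of_int d \<noteq> 0"
  proof
    assume "of_int c * z + of_int d = 0"
    then have "Im (of_int c * z + of_int d) = 0" "Re (of_int c * z + of_int d) = 0" by simp_all
    then have "c = 0" "d = 0" using z by auto
    then show False using det by simp
  qed
  have "real_of_int a * real_of_int d - real_of_int b * real_of_int c = 1"
    using arg_cong[OF det, of real_of_int] by simp
  moreover have "Im ((of_int a * z + of_int b) * cnj (of_int c * z + of_int d)) =
      (real_of_int a * real_of_int d - real_of_int b * real_of_int c) * Im z"
    by (simp add: algebra_simps)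
  ultimately show "Im ((of_int a * z + of_int b) / (of_int c * z + of_int d)) > 0"
    unfolding Im_complex_div_gt_0 using z by simp
qed

text \<open>Euclid's algorithm on the left column: a translation makes the upper entry smaller than the lower
  one, and the inversion exchanges the two.\<close>

theorem Delta_modular:
  fixes a b c d :: int
  assumes "a * d - b * c = 1" "Im z > 0"
  shows "Delta ((of_int a * z + of_int b) / (of_int c * z + of_int d)) =
         (of_int c * z + of_int d) ^ 12 * Delta z"
  using assms
proof (induction "nat \<bar>c\<bar>" arbitrary: a b c d rule: less_induct)
  case less
  note det = less.prems(1) and z = less.prems(2)
  show ?case
  proof (cases "c = 0")
    case True
    then have "a * d = 1" using det by simp
    then have "a = 1 \<and> d = 1 \<or> a = -1 \<and> d = -1" using pos_zmult_eq_1_iff_lemma zmult_eq_1_iff by blast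
    then show ?thesis
      using True Delta_add_int[of z b] Delta_add_int[of z "-b"] by (auto simp: algebra_simps)
  next
    case False
    define n where "n = a div c"
    define a' b' where "a' = a - n * c" and "b' = b - n * d"
    have a': "nat \<bar>a'\<bar> < nat \<bar>c\<bar>"
      using False by (simp add: a'_def n_def minus_div_mult_eq_mod abs_mod_less)
    have det': "a' * d - b' * c = 1" using det by (simp add: a'_def b'_def algebra_simps)
    have det'': "(- c) * b' - (- d) * a' = 1" using det' by (simp add: algebra_simps)
    define u where "u = of_int a' * z + of_int b'"
    define v where "v = of_int c * z + of_int d"
    have nz: "u \<noteq> 0" "v \<noteq> 0"
      using det_1_automorphy(1)[OF det'' z] det_1_automorphy(1)[OF det' z] by (simp_all add: u_def v_def)
    have eq: "(of_int (- c) * z + of_int (- d)) / u = - v / u" by (simp add: v_def)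
    have "Im (- v / u) > 0"
      using det_1_automorphy(2)[OF det'' z] by (simp only: u_def[symmetric] eq)
    then have "Delta (- 1 / (- v / u)) = (- v / u) ^ 12 * Delta (- v / u)" by (rule Delta_S)
    also have "Delta (- v / u) = u ^ 12 * Delta z"
      using less.hyps[OF a' det'' z] by (simp only: u_def[symmetric] eq)
    also have "- 1 / (- v / u) = u / v" using nz by simp
    finally have "Delta (u / v) = v ^ 12 * Delta z" using nz by (simp add: power_divide)
    moreover have "(of_int a * z + of_int b) / v = u / v + of_int n"
      using nz(2) by (simp add: u_def a'_def b'_def v_def field_simps)
    ultimately show ?thesis by (simp add: Delta_add_int flip: v_def)
  qed
qed

section \<open>The slash operator\<close>

definition automorphy :: "int ^ 2 ^ 2 \<Rightarrow> complex \<Rightarrow> complex" where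
  "automorphy A z = of_int (A $ 2 $ 1) * z + of_int (A $ 2 $ 2)"

lemma slash_automorphy: "slash k A f z = automorphy A z powi (- k) * f (moebius A z)"
  by (simp add: slash_def automorphy_def)

lemma SL2Z_det: "A \<in> SL2Z \<Longrightarrow> A $ 1 $ 1 * A $ 2 $ 2 - A $ 1 $ 2 * A $ 2 $ 1 = 1"
  by (simp add: SL2Z_def det_2)

lemma Gamma0_SL2Z: "A \<in> Gamma0 N \<Longrightarrow> A \<in> SL2Z"
  by (simp add: Gamma0_def)

lemma automorphy_nonzero: "A \<in> SL2Z \<Longrightarrow> z \<in> upper_half_plane \<Longrightarrow> automorphy A z \<noteq> 0"
  using det_1_automorphy(1)[OF SL2Z_det] by (simp add: automorphy_def upper_half_plane_def)

lemma moebius_in_upper_half_plane: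
  "A \<in> SL2Z \<Longrightarrow> z \<in> upper_half_plane \<Longrightarrow> moebius A z \<in> upper_half_plane"
  using det_1_automorphy(2)[OF SL2Z_det] by (simp add: moebius_def upper_half_plane_def)

lemma slash_mult:
  assumes "A \<in> SL2Z" "z \<in> upper_half_plane"
  shows "slash (k + l) A (\<lambda>z. f z * g z) z = slash k A f z * slash l A g z"
  using automorphy_nonzero[OF assms]
  by (simp add: slash_automorphy power_int_diff power_int_minus field_simps)

lemma slash_powi:
  "slash (k * n) A (\<lambda>z. f z powi n) z = slash k A f z powi n"
  by (simp add: slash_automorphy power_int_mult_distrib power_int_mult flip: power_int_mult)

lemma slash_power:
  "slash (k * int n) A (\<lambda>z. f z ^ n) z = slash k A f z ^ n"
  using slash_powi[of k "int n" A f z] by simp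

lemma slash_prod:
  assumes "A \<in> SL2Z" "z \<in> upper_half_plane" "finite I"
  shows "slash (\<Sum>i\<in>I. k i) A (\<lambda>z. \<Prod>i\<in>I. f i z) z = (\<Prod>i\<in>I. slash (k i) A (f i) z)"
  using assms(3)
proof (induction I rule: finite_induct)
  case empty
  then show ?case by (simp add: slash_automorphy)
next
  case (insert i I)
  then show ?case using slash_mult[OF assms(1,2)] by simp
qed

lemma slash_cong:
  assumes "A \<in> SL2Z" "z \<in> upper_half_plane" "\<And>w. w \<in> upper_half_plane \<Longrightarrow> f w = g w"
  shows "slash k A f z = slash k A g z"
  using assms moebius_in_upper_half_plane by (simp add: slash_automorphy)

section \<open>Orders of Delta-quotients at the cusps\<close>

lemma Delta_scaled_invariant:
  assumes A: "A \<in> Gamma0 N" and d: "d dvd N" "d > 0" and z: "z \<in> upper_half_plane"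
  shows "slash 12 A (\<lambda>z. Delta (of_nat d * z)) z = Delta (of_nat d * z)"
proof -
  have "int d dvd A $ 2 $ 1" using A d(1) by (auto simp: Gamma0_def intro: dvd_trans)
  then obtain c where c: "A $ 2 $ 1 = int d * c" by auto
  have det: "A $ 1 $ 1 * A $ 2 $ 2 - (int d * A $ 1 $ 2) * c = 1"
    using SL2Z_det[OF Gamma0_SL2Z[OF A]] by (simp add: c mult_ac)
  have dz: "Im (of_nat d * z) > 0" using z d by (simp add: upper_half_plane_def)
  have "of_nat d * moebius A z =
      (of_int (A $ 1 $ 1) * (of_nat d * z) + of_int (int d * A $ 1 $ 2)) /
      (of_int c * (of_nat d * z) + of_int (A $ 2 $ 2))"
    by (simp add: moebius_def c algebra_simps)
  moreover have "automorphy A z = of_int c * (of_nat d * z) + of_int (A $ 2 $ 2)"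
    by (simp add: automorphy_def c algebra_simps)
  ultimately show ?thesis
    using Delta_modular[OF det dz] automorphy_nonzero[OF Gamma0_SL2Z[OF A] z]
    by (simp add: slash_automorphy power_int_minus)
qed

text \<open>The integral matrix \<open>diag(d, 1) A\<close> of determinant \<open>d\<close> is the product of a matrix in the
  modular group and an upper triangular matrix with entries \<open>a\<close>, \<open>b\<close>, \<open>e\<close>. Since the left column of
  \<open>A\<close> is coprime, the content \<open>a\<close> of the left column of the product is \<open>gcd d (A $ 2 $ 1)\<close>.\<close>

lemma Delta_scaled_slash:
  assumes A: "A \<in> SL2Z" and d: "d > 0"
  obtains a b e :: int where "a = gcd (int d) (A $ 2 $ 1)" "a > 0" "e > 0" "a * e = int d"
    "\<And>z. z \<in> upper_half_plane \<Longrightarrow> slash 12 A (\<lambda>z. Delta (of_nat d * z)) z =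
       of_int e powi (- 12) * Delta ((of_int a * z + of_int b) / of_int e)"
proof -
  define p q r s where pqrs: "p = A $ 1 $ 1" "q = A $ 1 $ 2" "r = A $ 2 $ 1" "s = A $ 2 $ 2"
  have det: "p * s - q * r = 1" using SL2Z_det[OF A] by (simp add: pqrs)
  define a where "a = gcd (int d) r"
  have a0: "a > 0" using d by (simp add: a_def)
  obtain d' r' where d': "int d = a * d'" and r': "r = a * r'"
    unfolding a_def by (metis dvdE gcd_dvd1 gcd_dvd2)
  have d'0: "d' > 0" using d d' a0 by (metis of_nat_0_less_iff zero_less_mult_pos)
  have "coprime d' r'"
  proof -
    have "\<bar>a\<bar> * gcd d' r' = a"
      using gcd_mult_distrib_int[of a d' r'] unfolding d'[symmetric] r'[symmetric] a_def[symmetric] .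
    then have "gcd d' r' = 1" using a0 by simp
    then show ?thesis by (simp add: coprime_iff_gcd_eq_1)
  qed
  moreover have "coprime p r'"
  proof (rule coprimeI)
    fix c assume "c dvd p" "c dvd r'"
    then have "c dvd p * s - q * r" by (simp add: r')
    then show "is_unit c" by (simp add: det)
  qed
  ultimately have "coprime (d' * p) r'" by simp
  then obtain y x where yx: "y * (d' * p) + x * r' = 1"
    by (metis bezout_int coprime_iff_gcd_eq_1)
  define b where "b = y * (int d * q) + x * s"
  have detB: "(d' * p) * y - (- x) * r' = 1" using yx by (simp add: mult_ac)
  have det': "p * s - q * (a * r') = 1" using det r' by simp
  have e1: "(d' * p) * b + (- x) * d' = int d * q"
    using det' yx unfolding b_def d' by algebra
  have e2: "r' * b + y * d' = s"
    using det' yx unfolding b_def d' by algebra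
  have "slash 12 A (\<lambda>z. Delta (of_nat d * z)) z =
       of_int d' powi (- 12) * Delta ((of_int a * z + of_int b) / of_int d')"
    if z: "z \<in> upper_half_plane" for z
  proof -
    define w where "w = (of_int a * z + of_int b) / of_int d'"
    have w: "Im w > 0" using z a0 d'0 by (simp add: w_def upper_half_plane_def)
    have wz: "of_int d' * w = of_int a * z + of_int b" using d'0 by (simp add: w_def)
    have 1: "of_int d' * (of_int (d' * p) * w + of_int (- x)) = of_nat d * (of_int p * z + of_int q)"
    proof -
      have "of_int d' * (of_int (d' * p) * w + of_int (- x)) =
          of_int (d' * p) * (of_int d' * w) + of_int (- x * d')" by (simp add: algebra_simps)
      also have "\<dots> = of_int (a * d' * p) * z + of_int ((d' * p) * b + (- x) * d')"
        unfolding wz by (simp add: algebra_simps)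
      also have "\<dots> = of_int (int d * p) * z + of_int (int d * q)" unfolding e1 d'[symmetric] ..
      finally show ?thesis by (simp add: algebra_simps)
    qed
    have 2: "of_int d' * (of_int r' * w + of_int y) = automorphy A z"
    proof -
      have "of_int d' * (of_int r' * w + of_int y) = of_int r' * (of_int d' * w) + of_int (y * d')"
        by (simp add: algebra_simps)
      also have "\<dots> = of_int (a * r') * z + of_int (r' * b + y * d')"
        unfolding wz by (simp add: algebra_simps)
      finally show ?thesis unfolding e2 r'[symmetric] by (simp add: automorphy_def pqrs)
    qed
    have "of_nat d * moebius A z = of_nat d * (of_int p * z + of_int q) / automorphy A z"
      by (simp add: moebius_def automorphy_def pqrs)
    also have "\<dots> = (of_int (d' * p) * w + of_int (- x)) / (of_int r' * w + of_int y)"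
      unfolding 1[symmetric] 2[symmetric] using d'0 by simp
    finally have "Delta (of_nat d * moebius A z) = (of_int r' * w + of_int y) ^ 12 * Delta w"
      using Delta_modular[OF detB w] by simp
    also have "of_int r' * w + of_int y = automorphy A z / of_int d'"
      unfolding 2[symmetric] using d'0 by simp
    finally have eq: "Delta (of_nat d * moebius A z) = (automorphy A z / of_int d') ^ 12 * Delta w" .
    have "automorphy A z ^ 12 \<noteq> 0" using automorphy_nonzero[OF A z] by simp
    then have "slash 12 A (\<lambda>z. Delta (of_nat d * z)) z = inverse (of_int d' ^ 12) * Delta w"
      unfolding slash_automorphy eq power_divide power_int_minus power_int_numeral
      by (simp add: field_simps)
    then show ?thesis unfolding w_def power_int_minus power_int_numeral .
  qed
  then show thesis using that[OF _ a0 d'0 d'[symmetric]] unfolding a_def pqrs by blast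
qed

text \<open>The order \<open>m\<close> is measured in the parameter \<open>exp (2 \<pi> i z / N)\<close> at every cusp, also at those of
  smaller width, so that all expansions use the same variable. The unit factor has no zeros in the whole disc, which
  expresses that \<open>f\<close> has none in the upper half plane.\<close>

definition unit_expansion :: "nat \<Rightarrow> int \<Rightarrow> (complex \<Rightarrow> complex) \<Rightarrow> bool" where
  "unit_expansion N m f \<longleftrightarrow> (\<exists>G. G holomorphic_on ball 0 1 \<and> (\<forall>x\<in>ball 0 1. G x \<noteq> 0) \<and>
     (\<forall>z\<in>upper_half_plane. f z = nome (z / of_nat N) powi m * G (nome (z / of_nat N))))"

lemma unit_expansion_cong:
  "unit_expansion N m f \<Longrightarrow> (\<And>z. z \<in> upper_half_plane \<Longrightarrow> g z = f z) \<Longrightarrow> unit_expansion N m g"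
  unfolding unit_expansion_def by simp

lemma unit_expansion_mult:
  assumes "unit_expansion N m f" "unit_expansion N n g"
  shows "unit_expansion N (m + n) (\<lambda>z. f z * g z)"
proof -
  obtain F where F: "F holomorphic_on ball 0 1" "\<forall>x\<in>ball 0 1. F x \<noteq> 0"
    "\<forall>z\<in>upper_half_plane. f z = nome (z / of_nat N) powi m * F (nome (z / of_nat N))"
    using assms(1) unfolding unit_expansion_def by blast
  obtain G where G: "G holomorphic_on ball 0 1" "\<forall>x\<in>ball 0 1. G x \<noteq> 0"
    "\<forall>z\<in>upper_half_plane. g z = nome (z / of_nat N) powi n * G (nome (z / of_nat N))"
    using assms(2) unfolding unit_expansion_def by blast
  show ?thesis unfolding unit_expansion_def
    by (rule exI[of _ "\<lambda>x. F x * G x"]) (use F G in \<open>auto simp: power_int_add intro!: holomorphic_intros\<close>)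
qed

lemma unit_expansion_powi:
  assumes "unit_expansion N m f"
  shows "unit_expansion N (n * m) (\<lambda>z. f z powi n)"
proof -
  obtain F where F: "F holomorphic_on ball 0 1" "\<forall>x\<in>ball 0 1. F x \<noteq> 0"
    "\<forall>z\<in>upper_half_plane. f z = nome (z / of_nat N) powi m * F (nome (z / of_nat N))"
    using assms(1) unfolding unit_expansion_def by blast
  show ?thesis unfolding unit_expansion_def
    by (rule exI[of _ "\<lambda>x. F x powi n"])
       (use F in \<open>auto simp: power_int_mult_distrib mult.commute[of n] simp flip: power_int_mult intro!: holomorphic_intros\<close>)
qed

lemma unit_expansion_prod:
  assumes "finite I" "\<And>i. i \<in> I \<Longrightarrow> unit_expansion N (m i) (f i)"
  shows "unit_expansion N (\<Sum>i\<in>I. m i) (\<lambda>z. \<Prod>i\<in>I. f i z)"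
  using assms
proof (induction I rule: finite_induct)
  case empty
  then show ?case unfolding unit_expansion_def by (auto intro!: exI[of _ "\<lambda>_. 1"])
next
  case (insert i I)
  then show ?case using unit_expansion_mult[of N "m i" "f i"] by simp
qed

lemma norm_nome_real: "norm (nome (of_real x)) = 1"
  by (simp add: nome_def norm_exp_eq_Re)

lemma Delta_scaled_expansion:
  assumes A: "A \<in> SL2Z" and N: "N > 0" and d: "d dvd N"
  shows "unit_expansion N ((gcd (int d) (A $ 2 $ 1))\<^sup>2 * int (N div d)) (slash 12 A (\<lambda>z. Delta (of_nat d * z)))"
proof -
  have d0: "d > 0" using d N by (cases "d = 0") auto
  obtain a b e where abe: "a = gcd (int d) (A $ 2 $ 1)" "a > 0" "e > 0" "a * e = int d"
    "\<And>z. z \<in> upper_half_plane \<Longrightarrow> slash 12 A (\<lambda>z. Delta (of_nat d * z)) z =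
       of_int e powi (- 12) * Delta ((of_int a * z + of_int b) / of_int e)"
    using Delta_scaled_slash[OF A d0] by metis
  define m where "m = nat (a\<^sup>2 * int (N div d))"
  have Nd: "N div d > 0" using d N d0 by (simp add: div_greater_zero_iff dvd_imp_le)
  have m: "int m = a\<^sup>2 * int (N div d)" "m > 0"
    using abe(2) Nd by (simp_all add: m_def)
  define \<zeta> where "\<zeta> = nome (of_int b / of_int e)"
  have \<zeta>: "norm \<zeta> = 1" "\<zeta> \<noteq> 0"
    unfolding \<zeta>_def using norm_nome_real[of "of_int b / of_int e"] by simp_all
  have nome_eq: "nome ((of_int a * z + of_int b) / of_int e) = \<zeta> * nome (z / of_nat N) ^ m" for z
  proof -
    have "of_int a / of_int e = (of_nat m / of_nat N :: complex)"
    proof -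
      have "a * int N = int m * e"
      proof -
        have "int N = int d * int (N div d)" using d by (simp flip: of_nat_mult)
        then show ?thesis by (simp add: m(1) abe(4)[symmetric] power2_eq_square mult_ac)
      qed
      then have "(of_int a * of_nat N :: complex) = of_nat m * of_int e"
        by (metis of_int_mult of_int_of_nat_eq)
      then show ?thesis using abe(3) N by (simp add: field_simps)
    qed
    then have "(of_int a * z + of_int b) / of_int e = of_int b / of_int e + of_nat m * (z / of_nat N)"
      by (simp add: add_divide_distrib) (metis times_divide_eq_left mult.commute times_divide_eq_right)
    then show ?thesis by (simp add: nome_add nome_power \<zeta>_def)
  qed
  define G where "G x = of_int e powi (- 12) * (\<zeta> * qpoch (\<zeta> * x ^ m) (\<zeta> * x ^ m) ^ 24)" for x
  have lt: "norm (\<zeta> * x ^ m) < 1" if "norm x < 1" for x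
    using that m(2) \<zeta> by (simp add: norm_mult norm_power power_less_one_iff)
  have "G holomorphic_on ball 0 1"
    unfolding G_def[abs_def] using lt by (intro holomorphic_intros qpoch_holomorphic) auto
  moreover have "\<forall>x\<in>ball 0 1. G x \<noteq> 0"
    using lt qpoch_self_nonzero \<zeta> abe(3) by (auto simp: G_def)
  moreover have "slash 12 A (\<lambda>z. Delta (of_nat d * z)) z =
      nome (z / of_nat N) powi (a\<^sup>2 * int (N div d)) * G (nome (z / of_nat N))"
    if "z \<in> upper_half_plane" for z
  proof -
    have "Delta ((of_int a * z + of_int b) / of_int e) = \<zeta> * nome (z / of_nat N) ^ m *
        qpoch (\<zeta> * nome (z / of_nat N) ^ m) (\<zeta> * nome (z / of_nat N) ^ m) ^ 24"
      by (simp only: Delta_qpoch nome_eq)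
    then show ?thesis
      unfolding abe(5)[OF that] m(1)[symmetric] by (simp add: G_def mult_ac)
  qed
  ultimately show ?thesis unfolding unit_expansion_def abe(1)[symmetric] by blast
qed

text \<open>Ligozat's formula for the order of \<open>\<Prod> Delta(\<delta> z) ^ r \<delta>\<close> at a cusp with lower entry \<open>c\<close>.\<close>

definition cusp_order :: "nat \<Rightarrow> (nat \<Rightarrow> int) \<Rightarrow> int \<Rightarrow> int" where
  "cusp_order N r c = (\<Sum>\<delta> | \<delta> dvd N. r \<delta> * ((gcd (int \<delta>) c)\<^sup>2 * int (N div \<delta>)))"

definition Delta_weight :: "nat \<Rightarrow> (nat \<Rightarrow> int) \<Rightarrow> int" where
  "Delta_weight N r = 12 * (\<Sum>\<delta> | \<delta> dvd N. r \<delta>)"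

text \<open>Eta-quotients with exponents divisible by 24 are the ones whose transformation behaviour follows directly from
  that of \<open>Delta\<close>.\<close>

definition Delta_quotient :: "nat \<Rightarrow> (nat \<Rightarrow> int) \<Rightarrow> complex \<Rightarrow> complex" where
  "Delta_quotient N r = eta_quotient N (\<lambda>\<delta>. 24 * r \<delta>)"

lemma eta_quotient_off [simp]: "z \<notin> upper_half_plane \<Longrightarrow> eta_quotient N r z = 0"
  by (simp add: eta_quotient_def)

lemma eta_quotient_nonzero:
  assumes "N > 0" "z \<in> upper_half_plane"
  shows "eta_quotient N r z \<noteq> 0"
proof -
  have "dedekind_eta (of_nat \<delta> * z) \<noteq> 0" if "\<delta> dvd N" for \<delta>
    using assms that dvd_pos_nat[of N \<delta>] by (auto simp: upper_half_plane_def intro!: dedekind_eta_nonzero)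
  then show ?thesis using assms by (simp add: eta_quotient_def)
qed

lemma eta_quotient_holomorphic:
  assumes "N > 0"
  shows "eta_quotient N r holomorphic_on upper_half_plane"
proof -
  have "(\<lambda>z. \<Prod>\<delta> | \<delta> dvd N. dedekind_eta (of_nat \<delta> * z) powi r \<delta>) holomorphic_on upper_half_plane"
    using assms dvd_pos_nat
    by (intro holomorphic_intros dedekind_eta_scaled_holomorphic)
       (auto simp: upper_half_plane_def intro!: dedekind_eta_nonzero)
  then show ?thesis
    by (rule holomorphic_transform) (simp add: eta_quotient_def)
qed

lemma eta_quotient_0: "z \<in> upper_half_plane \<Longrightarrow> eta_quotient N (\<lambda>_. 0) z = 1"
  by (simp add: eta_quotient_def)

lemma eta_quotient_add:
  assumes "N > 0"
  shows "eta_quotient N (\<lambda>\<delta>. r \<delta> + s \<delta>) z = eta_quotient N r z * eta_quotient N s z"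
proof (cases "z \<in> upper_half_plane")
  case True
  have "dedekind_eta (of_nat \<delta> * z) \<noteq> 0" if "\<delta> dvd N" for \<delta>
    using True that assms dvd_pos_nat[of N \<delta>] by (auto simp: upper_half_plane_def intro!: dedekind_eta_nonzero)
  then show ?thesis using True
    by (simp add: eta_quotient_def power_int_add flip: prod.distrib)
qed simp

lemma eta_quotient_powi:
  assumes "z \<in> upper_half_plane"
  shows "eta_quotient N (\<lambda>\<delta>. n * r \<delta>) z = eta_quotient N r z powi n"
proof -
  have "(\<Prod>i\<in>I. f i) powi n = (\<Prod>i\<in>I. f i powi n)" for f :: "nat \<Rightarrow> complex" and I
    by (induction I rule: infinite_finite_induct) (simp_all add: power_int_mult_distrib)
  then show ?thesis using assms
    by (simp add: eta_quotient_def mult.commute[of n] power_int_mult)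
qed

lemma Delta_quotient_prod:
  assumes "z \<in> upper_half_plane"
  shows "Delta_quotient N r z = (\<Prod>\<delta> | \<delta> dvd N. Delta (of_nat \<delta> * z) powi r \<delta>)"
  using assms by (simp add: Delta_quotient_def eta_quotient_def Delta_def power_int_mult)

lemma slash_Delta_quotient:
  assumes N: "N > 0" and A: "A \<in> SL2Z" and z: "z \<in> upper_half_plane"
  shows "slash (Delta_weight N r) A (Delta_quotient N r) z =
     (\<Prod>\<delta> | \<delta> dvd N. slash 12 A (\<lambda>z. Delta (of_nat \<delta> * z)) z powi r \<delta>)"
proof -
  have "slash (Delta_weight N r) A (Delta_quotient N r) z =
      slash (\<Sum>\<delta> | \<delta> dvd N. 12 * r \<delta>) A (\<lambda>z. \<Prod>\<delta> | \<delta> dvd N. Delta (of_nat \<delta> * z) powi r \<delta>) z"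
    unfolding Delta_weight_def sum_distrib_left
    by (rule slash_cong[OF A z]) (simp add: Delta_quotient_prod)
  also have "\<dots> = (\<Prod>\<delta> | \<delta> dvd N. slash (12 * r \<delta>) A (\<lambda>z. Delta (of_nat \<delta> * z) powi r \<delta>) z)"
    using N by (intro slash_prod[OF A z]) auto
  finally show ?thesis by (simp add: slash_powi)
qed

lemma Delta_quotient_invariant:
  assumes N: "N > 0" and A: "A \<in> Gamma0 N" and z: "z \<in> upper_half_plane"
  shows "slash (Delta_weight N r) A (Delta_quotient N r) z = Delta_quotient N r z"
  unfolding slash_Delta_quotient[OF N Gamma0_SL2Z[OF A] z] Delta_quotient_prod[OF z]
  using N by (intro prod.cong) (auto simp: Delta_scaled_invariant[OF A _ _ z] dvd_pos_nat)

lemma Delta_quotient_expansion: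
  assumes N: "N > 0" and A: "A \<in> SL2Z"
  shows "unit_expansion N (cusp_order N r (A $ 2 $ 1)) (slash (Delta_weight N r) A (Delta_quotient N r))"
proof -
  have "unit_expansion N (cusp_order N r (A $ 2 $ 1))
      (\<lambda>z. \<Prod>\<delta> | \<delta> dvd N. slash 12 A (\<lambda>z. Delta (of_nat \<delta> * z)) z powi r \<delta>)"
    unfolding cusp_order_def using N
    by (intro unit_expansion_prod unit_expansion_powi Delta_scaled_expansion[OF A N]) auto
  then show ?thesis
    by (rule unit_expansion_cong) (rule slash_Delta_quotient[OF N A])
qed

section \<open>Behaviour at infinity\<close>

text \<open>Common form of the two conditions at infinity, which differ in the condition \<open>P\<close> on the
  function of the local parameter.\<close>

definition expands_in :: "((complex \<Rightarrow> complex) \<Rightarrow> bool) \<Rightarrow> (complex \<Rightarrow> complex) \<Rightarrow> bool" where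
  "expands_in P f \<longleftrightarrow> (\<exists>(h::nat) g. h > 0 \<and> P g \<and> (\<forall>z\<in>upper_half_plane. f z = g (nome (z / of_nat h))))"

text \<open>Two expansions in different parameters \<open>exp (2 \<pi> i z / h)\<close> are brought to the product of the
  two denominators \<open>h\<close>.\<close>

lemma expands_in_combine:
  assumes pow: "\<And>g n. P g \<Longrightarrow> n > 0 \<Longrightarrow> P (\<lambda>x. g (x ^ n))"
    and op: "\<And>g1 g2. P g1 \<Longrightarrow> P g2 \<Longrightarrow> P (\<lambda>x. op (g1 x) (g2 x))"
    and f: "expands_in P f1" "expands_in P f2"
  shows "expands_in P (\<lambda>z. op (f1 z) (f2 z))"
proof -
  obtain h1 :: nat and g1 where 1: "h1 > 0" "P g1" "\<And>z. z\<in>upper_half_plane \<Longrightarrow> f1 z = g1 (nome (z / of_nat h1))"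
    using f(1) unfolding expands_in_def by blast
  obtain h2 :: nat and g2 where 2: "h2 > 0" "P g2" "\<And>z. z\<in>upper_half_plane \<Longrightarrow> f2 z = g2 (nome (z / of_nat h2))"
    using f(2) unfolding expands_in_def by blast
  have "nome (z / of_nat h1) = nome (z / of_nat (h1 * h2)) ^ h2"
    "nome (z / of_nat h2) = nome (z / of_nat (h1 * h2)) ^ h1" for z
    using 1(1) 2(1) by (simp_all add: nome_power)
  then have "\<forall>z\<in>upper_half_plane. op (f1 z) (f2 z) =
      (\<lambda>x. op (g1 (x ^ h2)) (g2 (x ^ h1))) (nome (z / of_nat (h1 * h2)))"
    using 1(3) 2(3) by simp
  moreover have "P (\<lambda>x. op (g1 (x ^ h2)) (g2 (x ^ h1)))"
    using 1 2 by (intro op pow)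
  moreover have "h1 * h2 > 0" using 1(1) 2(1) by simp
  ultimately show ?thesis unfolding expands_in_def by blast
qed

lemma holomorphic_at_infinity_eq: "holomorphic_at_infinity = expands_in (\<lambda>g. g analytic_on {0})"
  by (simp add: fun_eq_iff holomorphic_at_infinity_def expands_in_def nome_def)

lemma meromorphic_at_infinity_eq: "meromorphic_at_infinity = expands_in (\<lambda>g. g meromorphic_on {0})"
  by (simp add: fun_eq_iff meromorphic_at_infinity_def expands_in_def nome_def)

lemma analytic_power_substitution:
  "g analytic_on {0} \<Longrightarrow> n > 0 \<Longrightarrow> (\<lambda>x. g (x ^ n)) analytic_on {0::complex}"
  by (rule analytic_on_compose_gen[of "\<lambda>x. x ^ n" "{0}" g "{0}", unfolded o_def])
     (auto simp: zero_power intro!: analytic_intros)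

lemma meromorphic_power_substitution:
  "g meromorphic_on {0} \<Longrightarrow> n > 0 \<Longrightarrow> (\<lambda>x. g (x ^ n)) meromorphic_on {0::complex}"
  by (rule meromorphic_on_compose[of g "{0}"]) (auto simp: zero_power intro!: analytic_intros)

lemma holomorphic_at_infinity_add:
  "holomorphic_at_infinity f \<Longrightarrow> holomorphic_at_infinity g \<Longrightarrow> holomorphic_at_infinity (\<lambda>z. f z + g z)"
  unfolding holomorphic_at_infinity_eq
  by (rule expands_in_combine[where op = "(+)"]) (auto intro: analytic_power_substitution analytic_intros)

lemma holomorphic_at_infinity_mult:
  "holomorphic_at_infinity f \<Longrightarrow> holomorphic_at_infinity g \<Longrightarrow> holomorphic_at_infinity (\<lambda>z. f z * g z)"
  unfolding holomorphic_at_infinity_eq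
  by (rule expands_in_combine[where op = "(*)"]) (auto intro: analytic_power_substitution analytic_intros)

lemma meromorphic_at_infinity_add:
  "meromorphic_at_infinity f \<Longrightarrow> meromorphic_at_infinity g \<Longrightarrow> meromorphic_at_infinity (\<lambda>z. f z + g z)"
  unfolding meromorphic_at_infinity_eq
  by (rule expands_in_combine[where op = "(+)"]) (auto intro: meromorphic_power_substitution meromorphic_intros)

lemma meromorphic_at_infinity_mult:
  "meromorphic_at_infinity f \<Longrightarrow> meromorphic_at_infinity g \<Longrightarrow> meromorphic_at_infinity (\<lambda>z. f z * g z)"
  unfolding meromorphic_at_infinity_eq
  by (rule expands_in_combine[where op = "(*)"]) (auto intro: meromorphic_power_substitution meromorphic_intros)

lemma holomorphic_at_infinity_cong:
  "holomorphic_at_infinity f \<Longrightarrow> (\<And>z. z \<in> upper_half_plane \<Longrightarrow> g z = f z) \<Longrightarrow> holomorphic_at_infinity g"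
  unfolding holomorphic_at_infinity_def by metis

lemma meromorphic_at_infinity_cong:
  "meromorphic_at_infinity f \<Longrightarrow> (\<And>z. z \<in> upper_half_plane \<Longrightarrow> g z = f z) \<Longrightarrow> meromorphic_at_infinity g"
  unfolding meromorphic_at_infinity_def by metis

lemma holomorphic_imp_meromorphic_at_infinity:
  "holomorphic_at_infinity f \<Longrightarrow> meromorphic_at_infinity f"
  unfolding holomorphic_at_infinity_def meromorphic_at_infinity_def
  using analytic_on_imp_meromorphic_on by blast

lemma holomorphic_at_infinityI:
  "N > 0 \<Longrightarrow> g analytic_on {0} \<Longrightarrow> (\<And>z. z \<in> upper_half_plane \<Longrightarrow> f z = g (nome (z / of_nat N))) \<Longrightarrow>
   holomorphic_at_infinity f"
  unfolding holomorphic_at_infinity_eq expands_in_def by blast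

lemma holomorphic_at_infinity_const: "holomorphic_at_infinity (\<lambda>_. c)"
  by (rule holomorphic_at_infinityI[of 1 "\<lambda>_. c"]) auto

lemma holomorphic_at_infinity_power:
  "holomorphic_at_infinity f \<Longrightarrow> holomorphic_at_infinity (\<lambda>z. f z ^ n)"
  by (induction n) (auto intro: holomorphic_at_infinity_const holomorphic_at_infinity_mult)

lemma holomorphic_at_infinity_nome: "holomorphic_at_infinity nome"
  by (rule holomorphic_at_infinityI[of 1 "\<lambda>x. x"]) auto

lemma unit_expansion_holomorphic:
  assumes N: "N > 0" and m: "m \<ge> 0" and f: "unit_expansion N m f"
  shows "holomorphic_at_infinity f"
proof -
  obtain G where G: "G holomorphic_on ball 0 1"
    "\<forall>z\<in>upper_half_plane. f z = nome (z / of_nat N) powi m * G (nome (z / of_nat N))"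
    using f unfolding unit_expansion_def by blast
  have "G analytic_on {0}" 
    using G(1) by (auto simp: analytic_at intro!: exI[of _ "ball 0 1"])
  then have "(\<lambda>x. x ^ nat m * G x) analytic_on {0}" by (intro analytic_intros)
  then show ?thesis
    by (rule holomorphic_at_infinityI[OF N]) (use G(2) m in \<open>simp add: power_int_def\<close>)
qed

lemma unit_expansion_meromorphic:
  assumes N: "N > 0" and f: "unit_expansion N m f"
  shows "meromorphic_at_infinity f"
proof -
  obtain G where G: "G holomorphic_on ball 0 1"
    "\<forall>z\<in>upper_half_plane. f z = nome (z / of_nat N) powi m * G (nome (z / of_nat N))"
    using f unfolding unit_expansion_def by blast
  have "G analytic_on {0}" 
    using G(1) by (auto simp: analytic_at intro!: exI[of _ "ball 0 1"])
  then have "(\<lambda>x. x powi m * G x) meromorphic_on {0}"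
    by (intro meromorphic_intros analytic_on_imp_meromorphic_on) auto
  then show ?thesis
    unfolding meromorphic_at_infinity_eq expands_in_def using N G(2) by blast
qed

lemma meromorphic_clear_pole:
  assumes "g meromorphic_on {0::complex}"
  obtains n g' where "g' analytic_on {0}" "\<And>x. x \<noteq> 0 \<Longrightarrow> g' x = x ^ n * g x"
proof (cases "\<exists>\<^sub>F w in at 0. g w \<noteq> 0")
  case False
  define g' where "g' x = (if x = 0 then 0 else g x)" for x
  have "\<forall>\<^sub>F w in at 0. g w = 0" using False by (simp add: not_frequently)
  then have "\<forall>\<^sub>F w in nhds 0. g' w = 0"
    unfolding eventually_at_filter by eventually_elim (simp add: g'_def)
  then have "g' analytic_on {0}" by (subst analytic_at_cong[of g' "\<lambda>_. 0"]) auto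
  then show thesis using that[of g' 0] by (simp add: g'_def)
next
  case True
  have "isolated_singularity_at g 0" "not_essential g 0"
    using assms by (simp_all add: meromorphic_at_iff)
  from zorder_exist[OF this True] obtain r where r: "r > 0" "zor_poly g 0 holomorphic_on cball 0 r"
    "\<And>w. w \<in> cball 0 r - {0} \<Longrightarrow> g w = zor_poly g 0 w * (w - 0) powi zorder g 0"
    by blast
  define n where "n = nat (- zorder g 0)"
  define m where "m = nat (zorder g 0 + int n)"
  have nm: "int n + zorder g 0 = int m" by (simp add: n_def m_def)
  define P where "P x = zor_poly g 0 x * x ^ m" for x
  define g' where "g' x = (if x = 0 then P 0 else x ^ n * g x)" for x
  have "zor_poly g 0 analytic_on {0}"
    using r(1,2) holomorphic_on_subset[OF r(2), of "ball 0 r"] by (auto simp: analytic_at intro!: exI[of _ "ball 0 r"])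
  then have P: "P analytic_on {0}" unfolding P_def[abs_def] by (intro analytic_intros)
  have "g' w = P w" if "w \<in> ball 0 r" for w
  proof (cases "w = 0")
    case False
    then have "w ^ n * g w = zor_poly g 0 w * w powi (int n + zorder g 0)"
      using r(3)[of w] that by (simp add: power_int_add)
    then show ?thesis using False unfolding nm by (simp add: g'_def P_def)
  qed (simp add: g'_def)
  then have "\<forall>\<^sub>F w in nhds 0. g' w = P w"
    using r(1) eventually_nhds_in_open[of "ball 0 r" 0] by (auto elim: eventually_mono)
  then have "g' analytic_on {0}" using P by (subst analytic_at_cong[of g' P]) auto
  then show thesis using that[of g' n] by (simp add: g'_def)
qed

lemma meromorphic_at_infinity_clear_pole:
  assumes "meromorphic_at_infinity f"
  obtains n where "holomorphic_at_infinity (\<lambda>z. nome z ^ n * f z)"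
proof -
  obtain h :: nat and g where h: "h > 0" "g meromorphic_on {0}"
    "\<And>z. z \<in> upper_half_plane \<Longrightarrow> f z = g (nome (z / of_nat h))"
    using assms unfolding meromorphic_at_infinity_eq expands_in_def by blast
  obtain n g' where g': "g' analytic_on {0}" "\<And>x. x \<noteq> 0 \<Longrightarrow> g' x = x ^ n * g x"
    using meromorphic_clear_pole[OF h(2)] by blast
  obtain h' where h': "h = Suc h'" using h(1) by (cases h) auto
  have nome: "nome z ^ n = nome (z / of_nat h) ^ (h' * n) * nome (z / of_nat h) ^ n" for z
  proof -
    have "nome z = nome (z / of_nat h) ^ h" using h(1) by (simp add: nome_power)
    then show ?thesis by (simp add: h' power_mult power_mult_distrib)
  qed
  have "holomorphic_at_infinity (\<lambda>z. nome z ^ n * f z)"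
  proof (rule holomorphic_at_infinityI[OF h(1), of "\<lambda>x. x ^ (h' * n) * g' x"])
    show "(\<lambda>x. x ^ (h' * n) * g' x) analytic_on {0}" by (intro analytic_intros g')
    show "nome z ^ n * f z = nome (z / of_nat h) ^ (h' * n) * g' (nome (z / of_nat h))"
      if "z \<in> upper_half_plane" for z
      unfolding nome[of z] using g'(2)[of "nome (z / of_nat h)"] h(3)[OF that] by simp
  qed
  then show thesis by (rule that)
qed

section \<open>The spaces R, M and E\<close>

text \<open>Turns the condition on cusps into one on matrices: the lower left entry is divisible by
  \<open>N\<close> exactly for the matrices in \<open>Gamma0 N\<close>.\<close>

lemma cusp_equiv_infinity_iff:
  assumes A: "A \<in> SL2Z"
  shows "cusp_equiv N (moebius_cusp A None) None \<longleftrightarrow> int N dvd A $ 2 $ 1"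
proof -
  define p q r s where pqrs: "p = A $ 1 $ 1" "q = A $ 1 $ 2" "r = A $ 2 $ 1" "s = A $ 2 $ 2"
  have det: "p * s - q * r = 1" using SL2Z_det[OF A] by (simp add: pqrs)
  show ?thesis
  proof
    assume "cusp_equiv N (moebius_cusp A None) None"
    then obtain B where B: "B \<in> Gamma0 N" "moebius_cusp B (moebius_cusp A None) = None"
      by (auto simp: cusp_equiv_def simp del: moebius_cusp.simps)
    show "int N dvd A $ 2 $ 1"
    proof (cases "r = 0")
      case False
      then have "moebius_cusp A None = Some (of_int p / of_int r)" by (simp add: pqrs)
      then have "of_int (B $ 2 $ 1) * (of_int p / of_int r) + of_int (B $ 2 $ 2) = (0::rat)"
        using B(2) by (simp split: if_splits)
      then have "of_int (B $ 2 $ 1 * p + B $ 2 $ 2 * r) = (0::rat)"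
        using False by (simp add: field_simps)
      then have eq: "B $ 2 $ 1 * p + B $ 2 $ 2 * r = 0" by (simp only: of_int_eq_0_iff)
      have N: "int N dvd B $ 2 $ 1" using B(1) by (simp add: Gamma0_def)
      have "r = r * (B $ 1 $ 1 * B $ 2 $ 2 - B $ 1 $ 2 * B $ 2 $ 1)"
        using SL2Z_det[OF Gamma0_SL2Z[OF B(1)]] by simp
      also have "\<dots> = B $ 2 $ 1 * (- (B $ 1 $ 1 * p) - r * B $ 1 $ 2)"
        using eq by algebra
      finally show ?thesis using N unfolding pqrs(3)[symmetric] by (metis dvd_mult2)
    qed (simp add: pqrs)
  next
    assume dvd: "int N dvd A $ 2 $ 1"
    \<comment> \<open>the inverse of \<open>A\<close>\<close>
    define B :: "int ^ 2 ^ 2" where "B = vector [vector [s, - q], vector [- r, p]]"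
    have "B \<in> Gamma0 N"
      using det dvd by (simp add: B_def Gamma0_def SL2Z_def det_2 pqrs mult_ac)
    moreover have "moebius_cusp B (moebius_cusp A None) = None"
      by (simp add: B_def pqrs)
    ultimately show "cusp_equiv N (moebius_cusp A None) None"
      by (auto simp: cusp_equiv_def simp del: moebius_cusp.simps)
  qed
qed

lemma weakly_holomorphic_form_iff:
  "weakly_holomorphic_form N k f \<longleftrightarrow> (\<forall>z. z \<notin> upper_half_plane \<longrightarrow> f z = 0) \<and> f holomorphic_on upper_half_plane \<and>
     (\<forall>A\<in>Gamma0 N. \<forall>z\<in>upper_half_plane. slash k A f z = f z) \<and>
     (\<forall>A\<in>SL2Z. meromorphic_at_infinity (slash k A f))"
proof -
  have "(\<forall>s. \<forall>A\<in>SL2Z. moebius_cusp A None = s \<longrightarrow> H A) \<longleftrightarrow> (\<forall>A\<in>SL2Z. H A)" for H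
    by blast
  then show ?thesis unfolding weakly_holomorphic_form_def meromorphic_at_cusp_def by simp
qed

lemma weakly_holomorphic_form_mult:
  assumes f: "weakly_holomorphic_form N k f" and g: "weakly_holomorphic_form N l g"
  shows "weakly_holomorphic_form N (k + l) (\<lambda>z. f z * g z)"
  unfolding weakly_holomorphic_form_iff
proof (intro conjI allI ballI impI)
  show "meromorphic_at_infinity (slash (k + l) A (\<lambda>z. f z * g z))" if "A \<in> SL2Z" for A
    by (rule meromorphic_at_infinity_cong[OF meromorphic_at_infinity_mult[of "slash k A f" "slash l A g"]])
       (use f g that slash_mult[OF that] in \<open>auto simp: weakly_holomorphic_form_iff\<close>)
  show "slash (k + l) A (\<lambda>z. f z * g z) z = f z * g z" if "A \<in> Gamma0 N" "z \<in> upper_half_plane" for A z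
    using f g that slash_mult[OF Gamma0_SL2Z[OF that(1)] that(2)] by (simp add: weakly_holomorphic_form_iff)
qed (use f g in \<open>auto simp: weakly_holomorphic_form_iff intro!: holomorphic_intros\<close>)

lemma R_space_iff_weakly_holomorphic:
  "f \<in> R_space N k \<longleftrightarrow> weakly_holomorphic_form N k f \<and>
     (\<forall>A\<in>SL2Z. \<not> int N dvd A $ 2 $ 1 \<longrightarrow> holomorphic_at_infinity (slash k A f))"
proof -
  have "(\<forall>s. \<not> cusp_equiv N s None \<longrightarrow> (\<forall>A\<in>SL2Z. moebius_cusp A None = s \<longrightarrow> H A)) \<longleftrightarrow>
      (\<forall>A\<in>SL2Z. \<not> cusp_equiv N (moebius_cusp A None) None \<longrightarrow> H A)" for H
    by blast
  also have "\<dots> H \<longleftrightarrow> (\<forall>A\<in>SL2Z. \<not> int N dvd A $ 2 $ 1 \<longrightarrow> H A)" for H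
    using cusp_equiv_infinity_iff by blast
  finally have *: "(\<forall>s. \<not> cusp_equiv N s None \<longrightarrow> (\<forall>A\<in>SL2Z. moebius_cusp A None = s \<longrightarrow> H A)) \<longleftrightarrow>
      (\<forall>A\<in>SL2Z. \<not> int N dvd A $ 2 $ 1 \<longrightarrow> H A)" for H .
  show ?thesis
    unfolding R_space_def holomorphic_at_cusp_def mem_Collect_eq * ..
qed

lemma R_space_iff:
  "f \<in> R_space N k \<longleftrightarrow> (\<forall>z. z \<notin> upper_half_plane \<longrightarrow> f z = 0) \<and> f holomorphic_on upper_half_plane \<and>
     (\<forall>A\<in>Gamma0 N. \<forall>z\<in>upper_half_plane. slash k A f z = f z) \<and>
     (\<forall>A\<in>SL2Z. meromorphic_at_infinity (slash k A f)) \<and>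
     (\<forall>A\<in>SL2Z. \<not> int N dvd A $ 2 $ 1 \<longrightarrow> holomorphic_at_infinity (slash k A f))"
  unfolding R_space_iff_weakly_holomorphic weakly_holomorphic_form_iff by blast

lemma M_space_iff:
  "f \<in> M_space N k \<longleftrightarrow> f \<in> R_space N k \<and> (\<forall>A\<in>SL2Z. holomorphic_at_infinity (slash k A f))"
  unfolding M_space_def R_space_def holomorphic_at_cusp_def
  by (auto simp del: moebius_cusp.simps)

lemma M_space_subset_R_space: "M_space N k \<subseteq> R_space N k"
  by (simp add: subset_iff M_space_iff)

lemma R_space_off: "f \<in> R_space N k \<Longrightarrow> z \<notin> upper_half_plane \<Longrightarrow> f z = 0"
  by (simp add: R_space_iff)

lemma slash_add: "slash k A (\<lambda>z. f z + g z) = (\<lambda>z. slash k A f z + slash k A g z)"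
  by (simp add: slash_def fun_eq_iff algebra_simps)

lemma slash_scale: "slash k A (\<lambda>z. c * f z) = (\<lambda>z. c * slash k A f z)"
  by (simp add: slash_def fun_eq_iff)

lemma R_space_add: "f \<in> R_space N k \<Longrightarrow> g \<in> R_space N k \<Longrightarrow> (\<lambda>z. f z + g z) \<in> R_space N k"
  unfolding R_space_iff slash_add
  by (auto intro!: holomorphic_intros meromorphic_at_infinity_add holomorphic_at_infinity_add)

lemma R_space_scale: "f \<in> R_space N k \<Longrightarrow> (\<lambda>z. c * f z) \<in> R_space N k"
  unfolding R_space_iff slash_scale
  by (auto intro!: holomorphic_intros meromorphic_at_infinity_mult holomorphic_at_infinity_mult
      holomorphic_at_infinity_const holomorphic_imp_meromorphic_at_infinity[OF holomorphic_at_infinity_const])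

lemma R_space_mult:
  assumes f: "f \<in> R_space N k" and g: "g \<in> R_space N l"
  shows "(\<lambda>z. f z * g z) \<in> R_space N (k + l)"
  unfolding R_space_iff_weakly_holomorphic
proof (intro conjI ballI impI)
  show "weakly_holomorphic_form N (k + l) (\<lambda>z. f z * g z)"
    using f g by (intro weakly_holomorphic_form_mult) (auto simp: R_space_iff_weakly_holomorphic)
  show "holomorphic_at_infinity (slash (k + l) A (\<lambda>z. f z * g z))"
    if "A \<in> SL2Z" "\<not> int N dvd A $ 2 $ 1" for A
    by (rule holomorphic_at_infinity_cong[OF holomorphic_at_infinity_mult[of "slash k A f" "slash l A g"]])
       (use f g that slash_mult[OF that(1)] in \<open>auto simp: R_space_iff\<close>)
qed

lemma R_space_const:
  "(\<lambda>z. if z \<in> upper_half_plane then c else 0) \<in> R_space N 0"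
proof -
  define f where "f z = (if z \<in> upper_half_plane then c else 0)" for z
  have slash: "slash 0 A f z = c" if "A \<in> SL2Z" "z \<in> upper_half_plane" for A z
    using moebius_in_upper_half_plane[OF that] by (simp add: slash_def f_def)
  then have "holomorphic_at_infinity (slash 0 A f)" if "A \<in> SL2Z" for A
    using that by (intro holomorphic_at_infinity_cong[OF holomorphic_at_infinity_const[of c]]) auto
  moreover have "f holomorphic_on upper_half_plane"
    by (rule holomorphic_transform[of "\<lambda>_. c"]) (auto simp: f_def)
  ultimately have "f \<in> R_space N 0"
    unfolding R_space_iff using slash Gamma0_SL2Z holomorphic_imp_meromorphic_at_infinity
    by (auto simp: f_def)
  then show ?thesis unfolding f_def[abs_def] .
qed

lemma R_space_power_Suc:
  assumes "f \<in> R_space N k" shows "(\<lambda>z. f z ^ Suc n) \<in> R_space N (k * int (Suc n))"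
proof (induction n)
  case 0
  then show ?case using assms by simp
next
  case (Suc n)
  then show ?case using R_space_mult[OF assms Suc] by (simp add: algebra_simps)
qed

lemma R_space_subspace: "cfun.subspace (R_space N k)"
proof (rule cfun.subspaceI)
  have "(\<lambda>z. 0 * (if z \<in> upper_half_plane then 1 else 0)) \<in> R_space N k"
    by (auto simp: R_space_iff slash_def[abs_def]
        intro: holomorphic_at_infinity_const holomorphic_imp_meromorphic_at_infinity[OF holomorphic_at_infinity_const])
  then show "0 \<in> R_space N k" by (simp add: zero_fun_def)
  show "x + y \<in> R_space N k" if "x \<in> R_space N k" "y \<in> R_space N k" for x y
    using R_space_add[OF that] by (simp add: plus_fun_def)
  show "(\<lambda>z. c * x z) \<in> R_space N k" if "x \<in> R_space N k" for c x
    using R_space_scale[OF that] .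
qed

lemma E_space_subset_R_space: "E_space N k \<subseteq> R_space N k"
  unfolding E_space_def by (rule cfun.span_minimal) (auto intro: R_space_subspace)

lemma E_space_base: "eta_quotient N r \<in> R_space N k \<Longrightarrow> eta_quotient N r \<in> E_space N k"
  unfolding E_space_def by (rule cfun.span_base) auto

lemma E_space_add: "f \<in> E_space N k \<Longrightarrow> g \<in> E_space N k \<Longrightarrow> (\<lambda>z. f z + g z) \<in> E_space N k"
  unfolding E_space_def using cfun.span_add by (simp add: plus_fun_def)

lemma E_space_scale: "f \<in> E_space N k \<Longrightarrow> (\<lambda>z. c * f z) \<in> E_space N k"
  unfolding E_space_def by (rule cfun.span_scale)

lemma E_space_zero: "(\<lambda>z. 0) \<in> E_space N k"
  unfolding E_space_def using cfun.span_zero by (simp add: zero_fun_def)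

lemma E_space_induct [consumes 1, case_names base zero add scale]:
  assumes "f \<in> E_space N k"
    and "\<And>r. eta_quotient N r \<in> R_space N k \<Longrightarrow> P (eta_quotient N r)"
    and "P (\<lambda>z. 0)" "\<And>f g. P f \<Longrightarrow> P g \<Longrightarrow> P (\<lambda>z. f z + g z)" "\<And>c f. P f \<Longrightarrow> P (\<lambda>z. c * f z)"
  shows "P f"
  using assms(1) unfolding E_space_def
proof (rule cfun.span_induct)
  show "cfun.subspace (Collect P)"
    using assms(3-5) by (intro cfun.subspaceI) (auto simp: zero_fun_def plus_fun_def)
qed (use assms(2) in auto)

lemma E_space_mult:
  assumes N: "N > 0" and "f \<in> E_space N k" "g \<in> E_space N l"
  shows "(\<lambda>z. f z * g z) \<in> E_space N (k + l)"
  using assms(2)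
proof (induction rule: E_space_induct)
  case (base r)
  show ?case using assms(3)
  proof (induction rule: E_space_induct)
    case (base s)
    have "(\<lambda>z. eta_quotient N r z * eta_quotient N s z) = eta_quotient N (\<lambda>\<delta>. r \<delta> + s \<delta>)"
      by (simp add: fun_eq_iff eta_quotient_add[OF N])
    then show ?case
      using R_space_mult[OF \<open>eta_quotient N r \<in> R_space N k\<close> base] by (simp add: E_space_base)
  next
    case (add f g)
    then show ?case using E_space_add by (simp add: distrib_left)
  next
    case (scale c f)
    then show ?case using E_space_scale[of _ N "k + l" c] by (simp add: mult.left_commute)
  qed (simp add: E_space_zero)
next
  case (add f g)
  then show ?case using E_space_add by (simp add: distrib_right)
next
  case (scale c f)
  then show ?case using E_space_scale[of _ N "k + l" c] by (simp add: mult.assoc)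
qed (simp add: E_space_zero)

lemma Delta_quotient_weakly_holomorphic:
  assumes N: "N > 0"
  shows "weakly_holomorphic_form N (Delta_weight N r) (Delta_quotient N r)"
  unfolding weakly_holomorphic_form_iff
  using Delta_quotient_expansion[OF N] unit_expansion_meromorphic[OF N]
    Delta_quotient_invariant[OF N] eta_quotient_holomorphic[OF N]
  by (auto simp: Delta_quotient_def)

lemma Delta_quotient_in_R_space:
  assumes N: "N > 0" and ord: "\<And>c. \<not> int N dvd c \<Longrightarrow> cusp_order N r c \<ge> 0"
  shows "Delta_quotient N r \<in> R_space N (Delta_weight N r)"
  unfolding R_space_iff_weakly_holomorphic
  using Delta_quotient_weakly_holomorphic[OF N] Delta_quotient_expansion[OF N]
    unit_expansion_holomorphic[OF N ord] by blast

section \<open>An eta-quotient whose zeros all lie at infinity\<close>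

lemma gcd_coprime_mult:
  assumes "coprime (a::int) b" "a > 0" "b > 0"
  shows "gcd (a * b) c = gcd a c * gcd b c"
proof (rule zdvd_antisym_nonneg)
  obtain x y where xy: "gcd (a * b) c = x * y" "x dvd a" "y dvd b"
    using division_decomp[of "gcd (a * b) c" a b] by auto
  then have "x dvd gcd a c" "y dvd gcd b c"
    by (metis dvd_mult_left dvd_mult_right gcd_dvd2 gcd_greatest)+
  then show "gcd (a * b) c dvd gcd a c * gcd b c" unfolding xy by (rule mult_dvd_mono)
  have "coprime (gcd a c) (gcd b c)"
    using assms(1) by (meson coprime_divisors gcd_dvd1)
  then have "gcd a c * gcd b c dvd c" by (intro divides_mult) auto
  then show "gcd a c * gcd b c dvd gcd (a * b) c" by (simp add: mult_dvd_mono)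
qed auto

lemma gcd_prime_power_Suc:
  fixes c :: int
  assumes p: "prime p"
  shows "gcd (int (p ^ Suc b)) c = (if int (p ^ Suc b) dvd c then int (p ^ Suc b) else gcd (int (p ^ b)) c)"
proof (cases "int (p ^ Suc b) dvd c")
  case True
  then show ?thesis by (simp add: gcd_proj1_iff del: of_nat_power power_Suc)
next
  case False
  define g where "g = nat (gcd (int (p ^ Suc b)) c)"
  have g: "int g = gcd (int (p ^ Suc b)) c" by (simp add: g_def)
  have "g dvd p ^ Suc b" using g by (metis gcd_dvd1 int_dvd_int_iff)
  then obtain j where j: "j \<le> Suc b" "g = p ^ j"
    using iffD1[OF divides_primepow_nat[OF p]] by blast
  have "int g dvd c" unfolding g by simp
  then have "j \<noteq> Suc b" using False j by auto
  then have "g dvd p ^ b" using j by (simp add: le_imp_power_dvd)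
  then have "int g dvd gcd (int (p ^ b)) c" using \<open>int g dvd c\<close> by (simp del: of_nat_power)
  moreover have "gcd (int (p ^ b)) c dvd int g" unfolding g
    by (metis dvd_triv_right gcd_dvd1 gcd_dvd2 gcd_greatest dvd_trans of_nat_dvd_iff power_Suc)
  ultimately have "int g = gcd (int (p ^ b)) c" by (intro zdvd_antisym_nonneg) auto
  then show ?thesis using False g by simp
qed

text \<open>The exponents of a Delta-quotient of positive weight with zeros at infinity only.\<close>

definition good_exponents :: "nat \<Rightarrow> (nat \<Rightarrow> int) \<Rightarrow> bool" where
  "good_exponents N s \<longleftrightarrow> (\<Sum>\<delta> | \<delta> dvd N. s \<delta>) > 0 \<and>
     (\<forall>c. \<not> int N dvd c \<longrightarrow> cusp_order N s c = 0) \<and> (\<forall>c. int N dvd c \<longrightarrow> cusp_order N s c > 0)"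

text \<open>Passes from a quotient \<open>F\<close> of level \<open>M\<close> to
  \<open>F(p ^ Suc b * z) ^ p / F(p ^ b * z)\<close>. This multiplies the orders by
  \<open>p (gcd(p ^ Suc b, c)\<^sup>2 - gcd(p ^ b, c)\<^sup>2)\<close>, which is positive if \<open>p ^ Suc b\<close> divides
  \<open>c\<close> and zero otherwise.\<close>

lemma good_exponents_prime_power:
  assumes p: "prime p" and M: "M > 0" "\<not> p dvd M" and s: "good_exponents M s"
  obtains s' where "good_exponents (p ^ Suc b * M) s'"
proof -
  define P where "P = p ^ b"
  define N where "N = p ^ Suc b * M"
  have p0: "p > 1" using p by (rule prime_gt_1_nat)
  have P0: "P > 0" using p0 by (simp add: P_def)
  have N: "N = p * P * M" by (simp add: N_def P_def)
  have N0: "N > 0" using N P0 p0 M by simp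
  define s' where "s' \<delta> = (if p * P dvd \<delta> then int p * s (\<delta> div (p * P))
     else if P dvd \<delta> then - s (\<delta> div P) else 0)" for \<delta>
  have not: "\<not> p * P dvd P * d" if "d dvd M" for d
  proof
    assume "p * P dvd P * d"
    then have "p dvd d" using P0 by (simp add: mult.commute[of p])
    then show False using that M(2) dvd_trans by blast
  qed
  have sum: "(\<Sum>\<delta> | \<delta> dvd N. s' \<delta> * \<phi> \<delta>) = (\<Sum>d | d dvd M. s d * (int p * \<phi> (p * P * d) - \<phi> (P * d)))"
    for \<phi> :: "nat \<Rightarrow> int"
  proof -
    define D where "D = {d. d dvd M}"
    have fin: "finite D" using M by (simp add: D_def)
    have inj: "inj_on (\<lambda>d. p * P * d) D" "inj_on (\<lambda>d. P * d) D"
      using p0 P0 by (auto simp: inj_on_def)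
    have "(\<Sum>\<delta> | \<delta> dvd N. s' \<delta> * \<phi> \<delta>) = (\<Sum>\<delta> \<in> (\<lambda>d. p * P * d) ` D \<union> (\<lambda>d. P * d) ` D. s' \<delta> * \<phi> \<delta>)"
    proof (rule sum.mono_neutral_right)
      show "finite {\<delta>. \<delta> dvd N}" using N0 by simp
      show "(\<lambda>d. p * P * d) ` D \<union> (\<lambda>d. P * d) ` D \<subseteq> {\<delta>. \<delta> dvd N}"
        by (auto simp: D_def N mult.assoc intro: mult_dvd_mono dvd_mult)
      show "\<forall>\<delta>\<in>{\<delta>. \<delta> dvd N} - ((\<lambda>d. p * P * d) ` D \<union> (\<lambda>d. P * d) ` D). s' \<delta> * \<phi> \<delta> = 0"
      proof
        fix \<delta> assume \<delta>: "\<delta> \<in> {\<delta>. \<delta> dvd N} - ((\<lambda>d. p * P * d) ` D \<union> (\<lambda>d. P * d) ` D)"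
        have "\<not> p * P dvd \<delta>"
        proof
          assume "p * P dvd \<delta>"
          then obtain d where d: "\<delta> = p * P * d" by auto
          then have "d dvd M" using \<delta> P0 p0 by (simp add: N)
          then show False using \<delta> d by (auto simp: D_def)
        qed
        moreover have "\<not> P dvd \<delta>"
        proof
          assume "P dvd \<delta>"
          then obtain d where d: "\<delta> = P * d" by auto
          then have "P * d dvd P * (p * M)" using \<delta> by (simp add: N mult_ac)
          then have dpM: "d dvd p * M" using P0 by simp
          have "\<not> p dvd d" using \<open>\<not> p * P dvd \<delta>\<close> d by (auto simp: mult_dvd_mono mult.commute)
          then have "coprime d p" using p prime_imp_coprime coprime_commute by blast
          then have "d dvd M" using dpM by (simp add: coprime_dvd_mult_right_iff)
          then show False using \<delta> d by (auto simp: D_def)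
        qed
        ultimately show "s' \<delta> * \<phi> \<delta> = 0" by (simp add: s'_def)
      qed
    qed
    also have "\<dots> = (\<Sum>\<delta> \<in> (\<lambda>d. p * P * d) ` D. s' \<delta> * \<phi> \<delta>) + (\<Sum>\<delta> \<in> (\<lambda>d. P * d) ` D. s' \<delta> * \<phi> \<delta>)"
    proof (rule sum.union_disjoint)
      have "p * P * d \<noteq> P * d'" if "d' \<in> D" for d d'
        using not[of d'] that by (metis D_def dvd_triv_left mem_Collect_eq)
      then show "(\<lambda>d. p * P * d) ` D \<inter> (\<lambda>d. P * d) ` D = {}" by blast
    qed (use fin in auto)
    also have "(\<Sum>\<delta> \<in> (\<lambda>d. p * P * d) ` D. s' \<delta> * \<phi> \<delta>) = (\<Sum>d\<in>D. int p * s d * \<phi> (p * P * d))"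
      unfolding sum.reindex[OF inj(1)] using p0 P0 by (intro sum.cong) (auto simp: s'_def)
    also have "(\<Sum>\<delta> \<in> (\<lambda>d. P * d) ` D. s' \<delta> * \<phi> \<delta>) = (\<Sum>d\<in>D. - s d * \<phi> (P * d))"
      unfolding sum.reindex[OF inj(2)] using P0 not by (intro sum.cong) (auto simp: s'_def D_def)
    finally show ?thesis
      by (simp add: D_def sum.distrib[symmetric] algebra_simps)
  qed
  have order: "cusp_order N s' c =
      int p * ((gcd (int (p ^ Suc b)) c)\<^sup>2 - (gcd (int (p ^ b)) c)\<^sup>2) * cusp_order M s c" for c
  proof -
    have "s d * (int p * ((gcd (int (p * P * d)) c)\<^sup>2 * int (N div (p * P * d))) -
          (gcd (int (P * d)) c)\<^sup>2 * int (N div (P * d))) =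
        int p * ((gcd (int (p ^ Suc b)) c)\<^sup>2 - (gcd (int (p ^ b)) c)\<^sup>2) *
          (s d * ((gcd (int d) c)\<^sup>2 * int (M div d)))"
      if dM: "d dvd M" for d
    proof -
      have d0: "d > 0" using dM M(1) dvd_pos_nat by blast
      have "\<not> p dvd d" using dM M(2) dvd_trans by blast
      then have "coprime p d" using p by (simp add: prime_imp_coprime)
      then have "coprime (int (p ^ k)) (int d)" for k by simp
      then have g: "gcd (int (p ^ k * d)) c = gcd (int (p ^ k)) c * gcd (int d) c" for k
        unfolding of_nat_mult using p0 d0 by (intro gcd_coprime_mult) auto
      obtain e where e: "M = d * e" using dM by blast
      have 1: "N div (p * P * d) = M div d" and 2: "N div (P * d) = p * (M div d)"
      proof -
        have "N = (p * P * d) * e" "N = (P * d) * (p * e)" by (simp_all add: N e mult_ac)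
        then show "N div (p * P * d) = M div d" "N div (P * d) = p * (M div d)"
          using p0 P0 d0 e by (metis mult_pos_pos nonzero_mult_div_cancel_left not_gr_zero zero_less_one less_trans)+
      qed
      have 3: "p * P * d = p ^ Suc b * d" "P * d = p ^ b * d" by (simp_all add: P_def)
      show ?thesis
        unfolding 1 2 unfolding 3 g by (simp add: power_mult_distrib algebra_simps)
    qed
    then show ?thesis
      unfolding cusp_order_def sum sum_distrib_left by (intro sum.cong) auto
  qed
  have cop: "coprime (int (p ^ Suc b)) (int M)"
    using p M(2) by (simp add: prime_imp_coprime)
  have dvd_iff: "int N dvd c \<longleftrightarrow> int (p ^ Suc b) dvd c \<and> int M dvd c" for c
    using divides_mult[OF _ _ cop] unfolding N_def of_nat_mult by (auto dest: dvd_mult_left dvd_mult_right)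
  have "good_exponents N s'"
    unfolding good_exponents_def
  proof (intro conjI allI impI)
    have "(\<Sum>\<delta> | \<delta> dvd N. s' \<delta>) = (int p - 1) * (\<Sum>d | d dvd M. s d)"
      using sum[of "\<lambda>_. 1"] by (simp add: sum_distrib_left mult.commute)
    then show "(\<Sum>\<delta> | \<delta> dvd N. s' \<delta>) > 0" using s p0 by (simp add: good_exponents_def)
  next
    fix c assume "\<not> int N dvd c"
    then consider "\<not> int (p ^ Suc b) dvd c" | "\<not> int M dvd c" using dvd_iff by blast
    then show "cusp_order N s' c = 0"
    proof cases
      case 1
      then show ?thesis using order[of c] gcd_prime_power_Suc[OF p, of b c] by simp
    next
      case 2
      then show ?thesis using order[of c] s by (simp add: good_exponents_def)
    qed
  next
    fix c assume c: "int N dvd c"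
    then have "gcd (int (p ^ Suc b)) c = int (p ^ Suc b)" "gcd (int (p ^ b)) c = int (p ^ b)"
      using dvd_iff[of c] by (auto simp: gcd_proj1_iff dest: dvd_mult_right simp del: of_nat_power)
    moreover have "(int (p ^ b))\<^sup>2 < (int (p ^ Suc b))\<^sup>2"
      using p0 by (intro power_strict_mono) auto
    moreover have "cusp_order M s c > 0" using s c dvd_iff by (simp add: good_exponents_def)
    ultimately show "cusp_order N s' c > 0"
      unfolding order using p0 by (simp del: of_nat_power)
  qed
  then show thesis using that unfolding N_def by blast
qed

lemma good_exponents_exist:
  "N > 0 \<Longrightarrow> \<exists>s. good_exponents N s"
proof (induction N rule: less_induct)
  case (less N)
  show ?case
  proof (cases "N = 1")
    case True
    have "good_exponents 1 (\<lambda>_. 1)" by (simp add: good_exponents_def cusp_order_def)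
    then show ?thesis using True by blast
  next
    case False
    then obtain p where p: "prime p" "p dvd N" using prime_factor_nat by blast
    obtain M where M: "N = p ^ multiplicity p N * M" "\<not> p dvd M"
      using multiplicity_decompose'[of N p] less.prems p(1) by (metis not_prime_unit less_irrefl)
    have "multiplicity p N > 0" using p less.prems by (simp add: prime_multiplicity_gt_zero_iff)
    then obtain b where b: "multiplicity p N = Suc b" by (cases "multiplicity p N") auto
    have NM: "N = p ^ Suc b * M" using M(1) b by simp
    have M0: "M > 0" using NM less.prems by (cases "M = 0") auto
    have "p ^ Suc b > 1" using prime_gt_1_nat[OF p(1)] by (rule one_less_power) simp
    then have "M < N" unfolding NM using M0 by simp
    then obtain s where "good_exponents M s" using less.IH M0 by blast
    then show ?thesis using good_exponents_prime_power[OF p(1) M0 M(2)] NM by metis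
  qed
qed


lemma Delta_weight_pos: "good_exponents N s \<Longrightarrow> Delta_weight N s > 0"
  by (simp add: good_exponents_def Delta_weight_def)

lemma Delta_quotient_powi:
  "z \<in> upper_half_plane \<Longrightarrow> Delta_quotient N (\<lambda>\<delta>. n * s \<delta>) z = Delta_quotient N s z powi n"
  using eta_quotient_powi[of z N n "\<lambda>\<delta>. 24 * s \<delta>"] by (simp add: Delta_quotient_def mult.left_commute)

text \<open>Here \<open>n\<close> may be negative: the orders away from infinity are 0.\<close>

lemma good_Delta_quotient_power_in_E_space:
  assumes N: "N > 0" and s: "good_exponents N s"
  shows "Delta_quotient N (\<lambda>\<delta>. n * s \<delta>) \<in> E_space N (n * Delta_weight N s)"
proof -
  have "cusp_order N (\<lambda>\<delta>. n * s \<delta>) c = n * cusp_order N s c" for c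
    by (simp add: cusp_order_def sum_distrib_left mult.assoc)
  then have "Delta_quotient N (\<lambda>\<delta>. n * s \<delta>) \<in> R_space N (Delta_weight N (\<lambda>\<delta>. n * s \<delta>))"
    using s by (intro Delta_quotient_in_R_space[OF N]) (simp add: good_exponents_def)
  moreover have "Delta_weight N (\<lambda>\<delta>. n * s \<delta>) = n * Delta_weight N s"
    by (simp add: Delta_weight_def sum_distrib_left[symmetric])
  ultimately show ?thesis unfolding Delta_quotient_def by (simp add: E_space_base)
qed

lemma E_space_cancel_good_Delta_quotient:
  assumes N: "N > 0" and s: "good_exponents N s"
    and off: "\<And>z. z \<notin> upper_half_plane \<Longrightarrow> f z = 0"
    and E: "(\<lambda>z. Delta_quotient N s z ^ j * f z) \<in> E_space N (Delta_weight N s * int j + k)"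
  shows "f \<in> E_space N k"
proof -
  define F' where "F' = Delta_quotient N (\<lambda>\<delta>. - int j * s \<delta>)"
  have "(\<lambda>z. F' z * (Delta_quotient N s z ^ j * f z)) \<in>
      E_space N (- int j * Delta_weight N s + (Delta_weight N s * int j + k))"
    unfolding F'_def by (rule E_space_mult[OF N good_Delta_quotient_power_in_E_space[OF N s] E])
  moreover have F'_cancel: "F' z * (Delta_quotient N s z ^ j * f z) = f z" for z
  proof (cases "z \<in> upper_half_plane")
    case True
    have "Delta_quotient N s z \<noteq> 0"
      unfolding Delta_quotient_def by (rule eta_quotient_nonzero[OF N True])
    moreover have "F' z = inverse (Delta_quotient N s z ^ j)"
      unfolding F'_def Delta_quotient_powi[OF True] power_int_minus power_int_of_nat ..
    ultimately show ?thesis by simp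
  qed (simp add: off)
  moreover have "(\<lambda>z. F' z * (Delta_quotient N s z ^ j * f z)) = f" by (rule ext) (rule F'_cancel)
  moreover have "- int j * Delta_weight N s + (Delta_weight N s * int j + k) = k" by simp
  ultimately show ?thesis by simp
qed

section \<open>From the spaces M to the spaces R\<close>

lemma slash_mat_1: "slash k (mat 1) f z = f z"
  by (simp add: slash_def moebius_def mat_def)

lemma mat_1_SL2Z: "mat 1 \<in> SL2Z"
  by (simp add: SL2Z_def)

lemma R_space_meromorphic_at_infinity: "f \<in> R_space N k \<Longrightarrow> meromorphic_at_infinity f"
  using mat_1_SL2Z by (auto simp: R_space_iff slash_mat_1[abs_def])

text \<open>Only the cusp infinity needs attention, and there \<open>F\<close> has a zero. The matrices with cusp equivalent to
  infinity lie in \<open>Gamma0 N\<close> and fix the product, so the single expansion at infinity suffices.\<close>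

lemma R_space_clear_pole:
  assumes N: "N > 0" and s: "good_exponents N s" and f: "f \<in> R_space N k"
  obtains j where "j > 0"
    "(\<lambda>z. Delta_quotient N s z ^ j * f z) \<in> M_space N (Delta_weight N s * int j + k)"
proof -
  define F where "F = Delta_quotient N s"
  define w where "w = Delta_weight N s"
  have F: "F \<in> R_space N w"
    using Delta_quotient_in_R_space[OF N, of s] s by (simp add: F_def w_def good_exponents_def)
  obtain n where n: "holomorphic_at_infinity (\<lambda>z. nome z ^ n * f z)"
    using meromorphic_at_infinity_clear_pole[OF R_space_meromorphic_at_infinity[OF f]] by blast
  define m where "m = nat (cusp_order N s 0)"
  have m: "cusp_order N s 0 = int m" "m > 0"
    using s by (auto simp: m_def good_exponents_def)
  have "(mat 1 :: int ^ 2 ^ 2) $ 2 $ 1 = 0" by (simp add: mat_def)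
  then have "unit_expansion N (int m) F"
    using Delta_quotient_expansion[OF N mat_1_SL2Z, of s] m(1)
    by (simp add: F_def slash_mat_1[abs_def])
  then obtain G where G: "G holomorphic_on ball 0 1"
    "\<And>z. z\<in>upper_half_plane \<Longrightarrow> F z = nome (z / of_nat N) ^ m * G (nome (z / of_nat N))"
    unfolding unit_expansion_def by auto
  define j where "j = N * Suc n"
  obtain e where e: "m * Suc n = n + e" using m(2)
    by (metis le_add_diff_inverse mult_le_mono1 Suc_leI nat_mult_1 Suc_leD One_nat_def)
  obtain j' where j': "j = Suc j'" using N by (cases j) (auto simp: j_def)
  define h where "h z = F z ^ j * f z" for z
  have hR: "h \<in> R_space N (w * int j + k)"
    unfolding h_def[abs_def] j' by (rule R_space_mult[OF R_space_power_Suc[OF F] f])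
  have "holomorphic_at_infinity (\<lambda>z. G (nome (z / of_nat N)))"
    using G(1) by (intro holomorphic_at_infinityI[OF N, of G]) (auto simp: analytic_at intro!: exI[of _ "ball 0 1"])
  then have "holomorphic_at_infinity (\<lambda>z. (nome z ^ n * f z) * (nome z ^ e * G (nome (z / of_nat N)) ^ j))"
    by (intro holomorphic_at_infinity_mult n holomorphic_at_infinity_power holomorphic_at_infinity_nome)
  moreover have "h z = (nome z ^ n * f z) * (nome z ^ e * G (nome (z / of_nat N)) ^ j)"
    if "z \<in> upper_half_plane" for z
  proof -
    have "nome (z / of_nat N) ^ N = nome z" using N by (simp add: nome_power)
    then have "(nome (z / of_nat N) ^ m) ^ j = nome z ^ (m * Suc n)"
      unfolding j_def by (metis mult.left_commute power_mult)
    then show ?thesis unfolding h_def G(2)[OF that] power_mult_distrib by (simp only: e power_add mult_ac)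
  qed
  ultimately have h_inf: "holomorphic_at_infinity h" by (rule holomorphic_at_infinity_cong)
  have "holomorphic_at_infinity (slash (w * int j + k) A h)" if A: "A \<in> SL2Z" for A
  proof (cases "int N dvd A $ 2 $ 1")
    case True
    then have "A \<in> Gamma0 N" using A by (simp add: Gamma0_def)
    then show ?thesis using hR by (intro holomorphic_at_infinity_cong[OF h_inf]) (simp add: R_space_iff)
  qed (use hR A in \<open>simp add: R_space_iff\<close>)
  then have "h \<in> M_space N (w * int j + k)" using hR by (simp add: M_space_iff)
  then show thesis using that[of j] j' by (simp add: h_def[abs_def] F_def w_def)
qed

theorem R_space_subset_E_space_if_M_space:
  assumes N: "N > 0" and M: "\<And>k::int. k > 0 \<Longrightarrow> even k \<Longrightarrow> M_space N k \<subseteq> E_space N k"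
    and k: "k \<ge> 0" "even k"
  shows "R_space N k \<subseteq> E_space N k"
proof
  fix f assume f: "f \<in> R_space N k"
  obtain s where s: "good_exponents N s" using good_exponents_exist[OF N] by blast
  obtain j where j: "j > 0" "(\<lambda>z. Delta_quotient N s z ^ j * f z) \<in> M_space N (Delta_weight N s * int j + k)"
    using R_space_clear_pole[OF N s f] by blast
  have "Delta_weight N s * int j + k > 0" "even (Delta_weight N s * int j + k)"
    using Delta_weight_pos[OF s] j(1) k by (auto simp: add_pos_nonneg) (simp add: Delta_weight_def)
  then have "(\<lambda>z. Delta_quotient N s z ^ j * f z) \<in> E_space N (Delta_weight N s * int j + k)"
    using M j(2) by blast
  from E_space_cancel_good_Delta_quotient[OF N s R_space_off[OF f] this]
  show "f \<in> E_space N k" .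
qed

section \<open>Logarithmic derivatives as forms of weight 2\<close>

lemma open_upper_half_plane: "open upper_half_plane"
  unfolding upper_half_plane_def by (rule open_halfspace_Im_gt)

lemma connected_upper_half_plane: "connected upper_half_plane"
  unfolding upper_half_plane_def by (intro convex_connected convex_halfspace_Im_gt)

lemma moebius_has_derivative:
  assumes A: "A \<in> SL2Z" and z: "z \<in> upper_half_plane"
  shows "(moebius A has_field_derivative automorphy A z powi (-2)) (at z)"
proof -
  have nz: "of_int (A $ 2 $ 1) * z + of_int (A $ 2 $ 2) \<noteq> 0"
    using automorphy_nonzero[OF A z] by (simp add: automorphy_def)
  have det: "of_int (A $ 1 $ 1) * of_int (A $ 2 $ 2) - of_int (A $ 1 $ 2) * of_int (A $ 2 $ 1) = (1::complex)"
    using arg_cong[OF SL2Z_det[OF A], of "of_int :: int \<Rightarrow> complex"] by simp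
  have "(moebius A has_field_derivative
      (of_int (A $ 1 $ 1) * (of_int (A $ 2 $ 1) * z + of_int (A $ 2 $ 2)) -
       (of_int (A $ 1 $ 1) * z + of_int (A $ 1 $ 2)) * of_int (A $ 2 $ 1)) /
      ((of_int (A $ 2 $ 1) * z + of_int (A $ 2 $ 2)) * (of_int (A $ 2 $ 1) * z + of_int (A $ 2 $ 2)))) (at z)"
    unfolding moebius_def[abs_def] using nz by (auto intro!: derivative_eq_intros)
  also have "of_int (A $ 1 $ 1) * (of_int (A $ 2 $ 1) * z + of_int (A $ 2 $ 2)) -
       (of_int (A $ 1 $ 1) * z + of_int (A $ 1 $ 2)) * of_int (A $ 2 $ 1) = (1::complex)"
    using det by (simp add: algebra_simps)
  finally show ?thesis
    by (simp add: automorphy_def power_int_minus power2_eq_square inverse_eq_divide)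
qed

text \<open>The derivative of a function of weight 0 behaves like a form of weight 2, because the derivative of a Moebius
  transformation of determinant 1 is \<open>(c z + d) powi (-2)\<close>.\<close>

lemma slash_has_derivative:
  assumes A: "A \<in> SL2Z" and z: "z \<in> upper_half_plane" and f: "f holomorphic_on upper_half_plane"
  shows "(slash 0 A f has_field_derivative slash 2 A (deriv f) z) (at z)"
proof -
  have "(f has_field_derivative deriv f (moebius A z)) (at (moebius A z))"
    by (rule holomorphic_derivI[OF f open_upper_half_plane moebius_in_upper_half_plane[OF A z]])
  from DERIV_chain2[OF this moebius_has_derivative[OF A z]]
  show ?thesis by (simp add: slash_automorphy[abs_def] mult.commute)
qed

lemma invariant_imp_deriv_invariant:
  assumes A: "A \<in> SL2Z" and f: "f holomorphic_on upper_half_plane"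
    and inv: "\<And>z. z \<in> upper_half_plane \<Longrightarrow> slash 0 A f z = f z" and z: "z \<in> upper_half_plane"
  shows "slash 2 A (deriv f) z = deriv f z"
proof -
  have "(f has_field_derivative slash 2 A (deriv f) z) (at z)"
    using has_field_derivative_transform_within_open[OF slash_has_derivative[OF A z f] open_upper_half_plane z inv] .
  then show ?thesis by (simp add: DERIV_imp_deriv)
qed

lemma nome_powi: "nome z powi n = nome (of_int n * z)"
  unfolding nome_def exp_power_int by (simp add: mult_ac)

lemma nome_has_derivative: "(nome has_field_derivative 2 * of_real pi * \<i> * nome z) (at z)"
  unfolding nome_def[abs_def] by (auto intro!: derivative_eq_intros)

text \<open>The logarithmic derivative of \<open>q ^ m * G(q)\<close> is, up to the factor from the chain rule,
  \<open>m + q * G'(q) / G(q)\<close>: its value at the cusp is the order.\<close>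

lemma unit_expansion_log_derivative:
  assumes N: "N > 0" and f: "unit_expansion N m f"
  obtains K where "K analytic_on {0}" "K 0 = 2 * of_real pi * \<i> / of_nat N * of_int m"
    "\<And>z. z \<in> upper_half_plane \<Longrightarrow> deriv f z / f z = K (nome (z / of_nat N))"
proof -
  obtain G where G: "G holomorphic_on ball 0 1" "\<forall>x\<in>ball 0 1. G x \<noteq> 0"
    "\<And>z. z\<in>upper_half_plane \<Longrightarrow> f z = nome (z / of_nat N) powi m * G (nome (z / of_nat N))"
    using f unfolding unit_expansion_def by blast
  define c where "c = 2 * of_real pi * \<i> / of_nat N"
  define K where "K x = c * (of_int m + x * deriv G x / G x)" for x
  have "K holomorphic_on ball 0 1"
    unfolding K_def[abs_def] using G by (intro holomorphic_intros) auto
  then have "K analytic_on {0}" by (auto simp: analytic_at intro!: exI[of _ "ball 0 1"])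
  moreover have "deriv f z / f z = K (nome (z / of_nat N))" if z: "z \<in> upper_half_plane" for z
  proof -
    define x where "x = nome (z / of_nat N)"
    have x: "x \<in> ball 0 1" using z N norm_nome_less_1[of "z / of_nat N"]
      by (simp add: x_def upper_half_plane_def)
    have 1: "((\<lambda>z. nome (z / of_nat N)) has_field_derivative c * x) (at z)"
    proof -
      have "((\<lambda>z. z / of_nat N) has_field_derivative 1 / of_nat N) (at z)"
        using N by (auto intro!: derivative_eq_intros)
      from DERIV_chain2[OF nome_has_derivative this] show ?thesis by (simp add: x_def c_def)
    qed
    have "((\<lambda>z. nome (of_int m * (z / of_nat N))) has_field_derivative
        (2 * of_real pi * \<i> * nome (of_int m * (z / of_nat N))) * (of_int m / of_nat N)) (at z)"
      by (rule DERIV_chain2[OF nome_has_derivative]) (use N in \<open>auto intro!: derivative_eq_intros\<close>)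
    then have 2: "((\<lambda>z. nome (z / of_nat N) powi m) has_field_derivative c * of_int m * x powi m) (at z)"
      unfolding nome_powi x_def c_def by (simp add: mult_ac)
    have "(G has_field_derivative deriv G x) (at x)"
      using G(1) x by (intro holomorphic_derivI[of _ "ball 0 1"]) auto
    then have 3: "((\<lambda>z. G (nome (z / of_nat N))) has_field_derivative deriv G x * (c * x)) (at z)"
      using DERIV_chain2[OF _ 1, of G "deriv G x"] by (simp add: x_def)
    have "((\<lambda>z. nome (z / of_nat N) powi m * G (nome (z / of_nat N))) has_field_derivative
        c * of_int m * x powi m * G x + deriv G x * (c * x) * x powi m) (at z)"
      using DERIV_mult[OF 2 3] unfolding x_def[symmetric] .
    then have "(f has_field_derivative c * of_int m * x powi m * G x + deriv G x * (c * x) * x powi m) (at z)"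
      by (rule has_field_derivative_transform_within_open[OF _ open_upper_half_plane z G(3)[symmetric]])
    then have "deriv f z = c * of_int m * x powi m * G x + deriv G x * (c * x) * x powi m"
      by (rule DERIV_imp_deriv)
    moreover have "f z = x powi m * G x" using G(3)[OF z] by (simp add: x_def)
    moreover have "x powi m \<noteq> 0" "G x \<noteq> 0" using G(2) x by (auto simp: x_def)
    ultimately show ?thesis unfolding K_def x_def[symmetric] by (simp add: field_simps)
  qed
  ultimately show thesis using that[of K] by (simp add: K_def c_def)
qed

definition log_derivative :: "(complex \<Rightarrow> complex) \<Rightarrow> complex \<Rightarrow> complex" where
  "log_derivative f z = (if z \<in> upper_half_plane then deriv f z / f z else 0)"

lemma slash_log_derivative:
  assumes A: "A \<in> SL2Z" and z: "z \<in> upper_half_plane" and f: "f holomorphic_on upper_half_plane"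
  shows "slash 2 A (log_derivative f) z = deriv (slash 0 A f) z / slash 0 A f z"
  using DERIV_imp_deriv[OF slash_has_derivative[OF A z f]] moebius_in_upper_half_plane[OF A z]
  by (simp add: slash_automorphy log_derivative_def)

lemma Delta_quotient_log_derivative:
  assumes N: "N > 0" and r: "Delta_weight N r = 0"
  defines "u \<equiv> log_derivative (Delta_quotient N r)"
  shows "u \<in> R_space N 2"
    and "\<And>A. A \<in> SL2Z \<Longrightarrow> \<exists>K. K analytic_on {0} \<and>
       K 0 = 2 * of_real pi * \<i> / of_nat N * of_int (cusp_order N r (A $ 2 $ 1)) \<and>
       (\<forall>z\<in>upper_half_plane. slash 2 A u z = K (nome (z / of_nat N)))"
proof -
  define f where "f = Delta_quotient N r"
  have hol: "f holomorphic_on upper_half_plane"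
    unfolding f_def Delta_quotient_def by (rule eta_quotient_holomorphic[OF N])
  have nz: "f z \<noteq> 0" if "z \<in> upper_half_plane" for z
    unfolding f_def Delta_quotient_def by (rule eta_quotient_nonzero[OF N that])
  show K: "\<exists>K. K analytic_on {0} \<and>
       K 0 = 2 * of_real pi * \<i> / of_nat N * of_int (cusp_order N r (A $ 2 $ 1)) \<and>
       (\<forall>z\<in>upper_half_plane. slash 2 A u z = K (nome (z / of_nat N)))" if A: "A \<in> SL2Z" for A
  proof -
    have "unit_expansion N (cusp_order N r (A $ 2 $ 1)) (slash 0 A f)"
      using Delta_quotient_expansion[OF N A, of r] by (simp add: r f_def)
    from unit_expansion_log_derivative[OF N this] slash_log_derivative[OF A _ hol]
    show ?thesis unfolding u_def f_def[symmetric] by metis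
  qed
  then have hol_inf: "holomorphic_at_infinity (slash 2 A u)" if "A \<in> SL2Z" for A
    using holomorphic_at_infinityI[OF N] that by metis
  have "u holomorphic_on upper_half_plane"
  proof (rule holomorphic_transform)
    show "(\<lambda>z. deriv f z / f z) holomorphic_on upper_half_plane"
      using hol nz open_upper_half_plane by (intro holomorphic_intros) auto
  qed (simp add: u_def f_def log_derivative_def)
  moreover have "slash 2 A u z = u z" if A: "A \<in> Gamma0 N" and z: "z \<in> upper_half_plane" for A z
  proof -
    have inv: "slash 0 A f w = f w" if "w \<in> upper_half_plane" for w
      using Delta_quotient_invariant[OF N A that, of r] by (simp add: r f_def)
    have "deriv (slash 0 A f) z = deriv f z"
      using invariant_imp_deriv_invariant[OF Gamma0_SL2Z[OF A] hol inv z]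
        DERIV_imp_deriv[OF slash_has_derivative[OF Gamma0_SL2Z[OF A] z hol]] by simp
    then show ?thesis
      unfolding u_def f_def[symmetric] slash_log_derivative[OF Gamma0_SL2Z[OF A] z hol]
      using inv[OF z] z by (simp add: log_derivative_def)
  qed
  ultimately show "u \<in> R_space N 2"
    unfolding R_space_iff using hol_inf holomorphic_imp_meromorphic_at_infinity
    by (auto simp: u_def log_derivative_def)
qed

text \<open>The logarithmic derivative of \<open>F / Delta ^ t\<close>, with \<open>t\<close> chosen to make the weight 0. Away from
  infinity \<open>F\<close> has order 0, so the order of the quotient is that of \<open>Delta ^ (- t)\<close>, which is negative.\<close>

lemma cusp_nonvanishing_weight_2_form:
  assumes N: "N > 0" and s: "good_exponents N s"
  obtains u where "u \<in> R_space N 2" "\<And>A. A \<in> SL2Z \<Longrightarrow> \<not> int N dvd A $ 2 $ 1 \<Longrightarrow>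
     \<exists>K. K analytic_on {0} \<and> K 0 \<noteq> 0 \<and> (\<forall>z\<in>upper_half_plane. slash 2 A u z = K (nome (z / of_nat N)))"
proof -
  define t where "t = (\<Sum>\<delta> | \<delta> dvd N. s \<delta>)"
  have t: "t > 0" using s by (simp add: t_def good_exponents_def)
  define r where "r \<delta> = s \<delta> - (if \<delta> = 1 then t else 0)" for \<delta>
  have fin: "finite {\<delta>. \<delta> dvd N}" using N by simp
  have "(\<Sum>\<delta> | \<delta> dvd N. r \<delta>) = 0"
    unfolding r_def sum_subtractf using fin by (simp add: t_def)
  then have w: "Delta_weight N r = 0" by (simp add: Delta_weight_def)
  have ord: "cusp_order N r c = - t * int N" if "\<not> int N dvd c" for c
  proof -
    have "cusp_order N r c = cusp_order N s c -
        (\<Sum>\<delta> | \<delta> dvd N. if \<delta> = 1 then t * ((gcd (int \<delta>) c)\<^sup>2 * int (N div \<delta>)) else 0)"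
      unfolding cusp_order_def sum_subtractf[symmetric]
      by (intro sum.cong) (auto simp: r_def algebra_simps)
    also have "cusp_order N s c = 0" using s that by (simp add: good_exponents_def)
    finally show ?thesis using fin by simp
  qed
  show thesis
  proof (rule that[OF Delta_quotient_log_derivative(1)[OF N w]])
    fix A :: "int ^ 2 ^ 2" assume A: "A \<in> SL2Z" "\<not> int N dvd A $ 2 $ 1"
    have "2 * of_real pi * \<i> / of_nat N * of_int (cusp_order N r (A $ 2 $ 1)) \<noteq> (0::complex)"
      using N t ord[OF A(2)] by simp
    then show "\<exists>K. K analytic_on {0} \<and> K 0 \<noteq> 0 \<and>
      (\<forall>z\<in>upper_half_plane. slash 2 A (log_derivative (Delta_quotient N r)) z = K (nome (z / of_nat N)))"
      using Delta_quotient_log_derivative(2)[OF N w A(1)] by metis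
  qed
qed

section \<open>The products of weights 2 and -2 generate the unit ideal\<close>

text \<open>If the bottom rows agree modulo \<open>N\<close>, then \<open>A B\<inverse>\<close> lies in \<open>Gamma0 N\<close>.\<close>

lemma slash_0_bottom_row_cong:
  assumes A: "A \<in> SL2Z" and B: "B \<in> SL2Z"
    and f: "\<And>C z. C \<in> Gamma0 N \<Longrightarrow> z \<in> upper_half_plane \<Longrightarrow> slash 0 C f z = f z"
    and row: "A $ 2 $ 1 mod int N = B $ 2 $ 1 mod int N" "A $ 2 $ 2 mod int N = B $ 2 $ 2 mod int N"
    and z: "z \<in> upper_half_plane"
  shows "slash 0 A f z = slash 0 B f z"
proof -
  define C :: "int ^ 2 ^ 2" where "C = vector [
      vector [A$1$1 * B$2$2 - A$1$2 * B$2$1, A$1$2 * B$1$1 - A$1$1 * B$1$2],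
      vector [A$2$1 * B$2$2 - A$2$2 * B$2$1, A$2$2 * B$1$1 - A$2$1 * B$1$2]]"
  have CB: "C$1$1 * B$1$1 + C$1$2 * B$2$1 = A$1$1" "C$1$1 * B$1$2 + C$1$2 * B$2$2 = A$1$2"
    "C$2$1 * B$1$1 + C$2$2 * B$2$1 = A$2$1" "C$2$1 * B$1$2 + C$2$2 * B$2$2 = A$2$2"
    using SL2Z_det[OF B] unfolding C_def vector_2 by algebra+
  have "C$1$1 * C$2$2 - C$1$2 * C$2$1 = 1"
    using SL2Z_det[OF A] SL2Z_det[OF B] unfolding C_def vector_2 by algebra
  moreover have "int N dvd C$2$1"
  proof -
    have "C$2$1 = (A$2$1 - B$2$1) * B$2$2 - (A$2$2 - B$2$2) * B$2$1"
      unfolding C_def by (simp add: algebra_simps)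
    then show ?thesis using row by (simp add: mod_eq_dvd_iff)
  qed
  ultimately have C: "C \<in> Gamma0 N" by (simp add: Gamma0_def SL2Z_def det_2)
  define w where "w = moebius B z"
  have w: "w \<in> upper_half_plane" unfolding w_def by (rule moebius_in_upper_half_plane[OF B z])
  have nB: "automorphy B z \<noteq> 0" by (rule automorphy_nonzero[OF B z])
  have e: "(of_int c * w + of_int d) * automorphy B z =
      of_int (c * B$1$1 + d * B$2$1) * z + of_int (c * B$1$2 + d * B$2$2)" for c d
  proof -
    have "w * automorphy B z = of_int (B$1$1) * z + of_int (B$1$2)"
      using nB by (simp add: w_def moebius_def automorphy_def)
    moreover have "(of_int c * w + of_int d) * automorphy B z =
        of_int c * (w * automorphy B z) + of_int d * automorphy B z"
      by (simp add: algebra_simps)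
    ultimately show ?thesis by (simp add: automorphy_def algebra_simps)
  qed
  have "moebius C w = ((of_int (C$1$1) * w + of_int (C$1$2)) * automorphy B z) /
      ((of_int (C$2$1) * w + of_int (C$2$2)) * automorphy B z)"
    using nB by (simp add: moebius_def)
  then have "moebius C w = moebius A z" unfolding e CB by (simp add: moebius_def)
  moreover have "slash 0 C f w = f w" by (rule f[OF C w])
  ultimately show ?thesis by (simp add: slash_automorphy w_def)
qed

text \<open>There are infinitely many matrices, but the expansion depends only on the bottom row modulo
  \<open>N\<close>.\<close>

lemma finitely_many_cusp_values:
  assumes N: "N > 0" and p: "p \<in> R_space N 0"
    and val: "\<And>A. A \<in> SL2Z \<Longrightarrow> \<not> int N dvd A $ 2 $ 1 \<Longrightarrow>
     \<exists>g. g analytic_on {0} \<and> g 0 \<noteq> 0 \<and> (\<forall>z\<in>upper_half_plane. slash 0 A p z = g (nome (z / of_nat N)))"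
  obtains V where "finite V" "0 \<notin> V" "\<And>A. A \<in> SL2Z \<Longrightarrow> \<not> int N dvd A $ 2 $ 1 \<Longrightarrow>
     \<exists>g. g analytic_on {0} \<and> g 0 \<in> V \<and> (\<forall>z\<in>upper_half_plane. slash 0 A p z = g (nome (z / of_nat N)))"
proof -
  define row :: "int ^ 2 ^ 2 \<Rightarrow> int \<times> int" where "row A = (A $ 2 $ 1 mod int N, A $ 2 $ 2 mod int N)" for A
  define X where "X = {A. A \<in> SL2Z \<and> \<not> int N dvd A $ 2 $ 1}"
  have "row ` X \<subseteq> {0..<int N} \<times> {0..<int N}" using N by (auto simp: row_def)
  then have fin: "finite (row ` X)" using finite_subset by blast
  have "\<forall>i\<in>row ` X. \<exists>A. A \<in> X \<and> row A = i" by auto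
  from bchoice[OF this] obtain a where a: "\<And>i. i \<in> row ` X \<Longrightarrow> a i \<in> X \<and> row (a i) = i" by blast
  have "\<forall>i\<in>row ` X. \<exists>g. g analytic_on {0} \<and> g 0 \<noteq> 0 \<and>
      (\<forall>z\<in>upper_half_plane. slash 0 (a i) p z = g (nome (z / of_nat N)))"
    using a val unfolding X_def by blast
  from bchoice[OF this] obtain g where g: "\<And>i. i \<in> row ` X \<Longrightarrow> g i analytic_on {0} \<and> g i 0 \<noteq> 0 \<and>
      (\<forall>z\<in>upper_half_plane. slash 0 (a i) p z = g i (nome (z / of_nat N)))" by blast
  show thesis
  proof (rule that[of "(\<lambda>i. g i 0) ` row ` X"])
    show "finite ((\<lambda>i. g i 0) ` row ` X)" using fin by simp
    show "0 \<notin> (\<lambda>i. g i 0) ` row ` X" using g by (metis (no_types, lifting) imageE)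
    fix A :: "int ^ 2 ^ 2" assume A: "A \<in> SL2Z" "\<not> int N dvd A $ 2 $ 1"
    then have i: "row A \<in> row ` X" by (simp add: X_def)
    have "row (a (row A)) = row A" "a (row A) \<in> SL2Z" using a[OF i] by (auto simp: X_def)
    then have "slash 0 A p z = slash 0 (a (row A)) p z" if "z \<in> upper_half_plane" for z
      using p by (intro slash_0_bottom_row_cong[OF A(1) _ _ _ _ that, of _ N])
        (auto simp: row_def R_space_iff)
    then show "\<exists>h. h analytic_on {0} \<and> h 0 \<in> (\<lambda>i. g i 0) ` row ` X \<and>
        (\<forall>z\<in>upper_half_plane. slash 0 A p z = h (nome (z / of_nat N)))"
      using g[OF i] i by (intro exI[of _ "g (row A)"]) auto
  qed
qed

text \<open>Compares, at the point \<open>\<i>\<close> and for the matrix with bottom row \<open>(N, 1)\<close>, the transformation of the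
  24th power as a form with its transformation as a Delta-quotient. The automorphy factor has absolute value greater
  than 1 there, so its exponent is determined.\<close>

lemma eta_quotient_weight:
  assumes N: "N > 0" and r: "eta_quotient N r \<in> R_space N k"
  shows "Delta_weight N r = 24 * k"
proof -
  define A :: "int ^ 2 ^ 2" where "A = vector [vector [1, 0], vector [int N, 1]]"
  have A: "A \<in> Gamma0 N" by (simp add: A_def Gamma0_def SL2Z_def det_2)
  have z: "\<i> \<in> upper_half_plane" by (simp add: upper_half_plane_def)
  define j where "j = automorphy A \<i>"
  have j: "j = of_nat N * \<i> + 1" by (simp add: j_def automorphy_def A_def)
  have "cmod j ^ 2 > 1" using N unfolding j cmod_power2 by simp
  then have nj: "cmod j > 1" using power_le_one[of "cmod j" 2] by (meson norm_ge_zero not_le)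
  define f where "f = eta_quotient N r"
  have f24: "Delta_quotient N r z = f z powi 24" if "z \<in> upper_half_plane" for z
    unfolding Delta_quotient_def f_def using eta_quotient_powi[OF that, of N 24 r] by simp
  have fnz: "f \<i> \<noteq> 0" unfolding f_def by (rule eta_quotient_nonzero[OF N z])
  have Az: "moebius A \<i> \<in> upper_half_plane" by (rule moebius_in_upper_half_plane[OF Gamma0_SL2Z[OF A] z])
  have "slash (k * 24) A (\<lambda>z. f z powi 24) \<i> = f \<i> powi 24"
    unfolding slash_powi using r A z by (simp add: R_space_iff f_def)
  then have 1: "j powi (- (k * 24)) * f (moebius A \<i>) powi 24 = f \<i> powi 24"
    by (simp add: slash_automorphy j_def)
  have 2: "j powi (- Delta_weight N r) * f (moebius A \<i>) powi 24 = f \<i> powi 24"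
    using Delta_quotient_invariant[OF N A z, of r] f24[OF z] f24[OF Az] by (simp add: slash_automorphy j_def)
  have "f (moebius A \<i>) \<noteq> 0" unfolding f_def by (rule eta_quotient_nonzero[OF N Az])
  then have "j powi (- (k * 24)) = j powi (- Delta_weight N r)" using 1 2 by (metis mult_right_cancel power_int_eq_0_iff)
  then have "cmod j powi (- (k * 24)) = cmod j powi (- Delta_weight N r)"
    by (metis norm_power_int)
  then have "- (k * 24) = - Delta_weight N r"
    using nj power_int_strict_increasing[of _ _ "cmod j"] by (metis linorder_neqE order_less_irrefl)
  then show ?thesis by simp
qed

lemma poly_in_R_space_0:
  assumes p: "p \<in> R_space N 0"
  shows "(\<lambda>z. if z \<in> upper_half_plane then poly T (p z) else 0) \<in> R_space N 0"
proof (induction T)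
  case 0
  then show ?case using R_space_const[of 0 N] by (simp cong: if_cong)
next
  case (pCons a T)
  have "(\<lambda>z. (if z \<in> upper_half_plane then a else 0) + p z * (if z \<in> upper_half_plane then poly T (p z) else 0))
      \<in> R_space N 0"
    using R_space_add[OF R_space_const[of a] R_space_mult[OF p pCons.IH, simplified]] by simp
  also have "(\<lambda>z. (if z \<in> upper_half_plane then a else 0) + p z * (if z \<in> upper_half_plane then poly T (p z) else 0)) =
      (\<lambda>z. if z \<in> upper_half_plane then poly (pCons a T) (p z) else 0)"
    by (auto simp: fun_eq_iff)
  finally show ?case .
qed

lemma analytic_root_factor:
  assumes "g analytic_on {0::complex}" "g 0 = 0"
  obtains g1 where "g1 analytic_on {0}" "\<And>x. g x = x * g1 x"
proof -
  obtain e where e: "e > 0" "g holomorphic_on ball 0 e" using assms(1) by (auto simp: analytic_on_def)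
  define g1 where "g1 x = (if x = 0 then deriv g 0 else (g x - g 0) / (x - 0))" for x
  have "g1 holomorphic_on ball 0 e" unfolding g1_def[abs_def]
    by (rule pole_lemma_open[OF e(2) open_ball])
  then have "g1 analytic_on {0}" using e(1) by (auto simp: analytic_at intro!: exI[of _ "ball 0 e"])
  moreover have "g x = x * g1 x" for x using assms(2) by (simp add: g1_def)
  ultimately show thesis using that by blast
qed

lemma cusp_order_bound:
  assumes N: "N > 0"
  obtains B where "\<And>c. cusp_order N r c \<le> int B"
proof -
  define b where "b = (\<Sum>\<delta> | \<delta> dvd N. \<bar>r \<delta>\<bar> * ((int \<delta>)\<^sup>2 * int (N div \<delta>)))"
  have "cusp_order N r c \<le> b" for c
    unfolding cusp_order_def b_def
  proof (intro sum_mono mult_mono power_mono)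
    fix \<delta> assume "\<delta> \<in> {\<delta>. \<delta> dvd N}"
    then have "\<delta> > 0" using N dvd_pos_nat by blast
    then show "gcd (int \<delta>) c \<le> int \<delta>" by (intro gcd_le1_int) simp
  qed auto
  moreover have "b \<ge> 0" unfolding b_def by (intro sum_nonneg) auto
  ultimately show thesis using that[of "nat b"] by simp
qed

text \<open>Division by an eta-quotient \<open>u\<close> is done as multiplication by \<open>u ^ 23\<close> and division by
  \<open>u ^ 24\<close>. The latter is a Delta-quotient, whose orders at the cusps are known and bounded, so that the zeros of a
  high power of \<open>p\<close> compensate them.\<close>

lemma cusp_vanishing_divisible_by_eta_quotient:
  assumes N: "N > 0" and u: "eta_quotient N r \<in> R_space N k"
    and p: "p \<in> R_space N 0"
    and van: "\<And>A. A \<in> SL2Z \<Longrightarrow> \<not> int N dvd A $ 2 $ 1 \<Longrightarrow>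
     \<exists>g. g analytic_on {0} \<and> g 0 = 0 \<and> (\<forall>z\<in>upper_half_plane. slash 0 A p z = g (nome (z / of_nat N)))"
  obtains n v where "n > 0" "v \<in> R_space N (- k)"
    "\<And>z. z \<in> upper_half_plane \<Longrightarrow> p z ^ n = eta_quotient N r z * v z"
proof -
  define u where "u = eta_quotient N r"
  define D where "D = Delta_quotient N (\<lambda>\<delta>. - r \<delta>)"
  obtain B where B: "\<And>c. cusp_order N r c \<le> int B" using cusp_order_bound[OF N] by metis
  \<comment> \<open>successors, because a zeroth power would be 1 outside the upper half plane, where forms are 0\<close>
  define v where "v z = p z ^ Suc B * (u z ^ Suc 22 * D z)" for z
  have w: "Delta_weight N (\<lambda>\<delta>. - r \<delta>) = - (24 * k)"
    using eta_quotient_weight[OF N u] by (simp add: Delta_weight_def sum_negf)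
  have ordD: "cusp_order N (\<lambda>\<delta>. - r \<delta>) c = - cusp_order N r c" for c
    by (simp add: cusp_order_def sum_negf)
  have uR: "u \<in> R_space N k" using u by (simp add: u_def)
  have p1: "(\<lambda>z. p z ^ Suc B) \<in> R_space N 0" using R_space_power_Suc[OF p, of B] by simp
  have u1: "(\<lambda>z. u z ^ Suc 22) \<in> R_space N (k * 23)" using R_space_power_Suc[OF uR, of 22] by simp
  have D1: "weakly_holomorphic_form N (- (24 * k)) D"
    using Delta_quotient_weakly_holomorphic[OF N, of "\<lambda>\<delta>. - r \<delta>"] w by (simp add: D_def)
  have wt: "0 + (k * 23 + - (24 * k)) = - k" by simp
  have vwh: "weakly_holomorphic_form N (- k) v"
    using weakly_holomorphic_form_mult[OF _ weakly_holomorphic_form_mult[OF _ D1], of 0 "\<lambda>z. p z ^ Suc B" "k * 23" "\<lambda>z. u z ^ Suc 22"]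
      p1 u1 unfolding wt v_def[abs_def] R_space_iff_weakly_holomorphic by blast
  have "holomorphic_at_infinity (slash (- k) A v)" if A: "A \<in> SL2Z" "\<not> int N dvd A $ 2 $ 1" for A
  proof -
    obtain g where g: "g analytic_on {0}" "g 0 = 0"
      "\<And>z. z\<in>upper_half_plane \<Longrightarrow> slash 0 A p z = g (nome (z / of_nat N))"
      using van[OF A] by blast
    obtain g1 where g1: "g1 analytic_on {0}" "\<And>x. g x = x * g1 x"
      using analytic_root_factor[OF g(1,2)] by blast
    define m where "m = cusp_order N r (A $ 2 $ 1)"
    obtain G where G: "G holomorphic_on ball 0 1"
      "\<And>z. z\<in>upper_half_plane \<Longrightarrow> slash (- (24 * k)) A D z =
         nome (z / of_nat N) powi (- m) * G (nome (z / of_nat N))"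
      using Delta_quotient_expansion[OF N A(1), of "\<lambda>\<delta>. - r \<delta>"]
      unfolding unit_expansion_def w ordD D_def[symmetric] m_def[symmetric] by blast
    define e where "e = nat (int (Suc B) - m)"
    have e: "int (Suc B) + - m = int e" using B[of "A $ 2 $ 1"] by (simp add: e_def m_def)
    have "G analytic_on {0}" using G(1) by (auto simp: analytic_at intro!: exI[of _ "ball 0 1"])
    then have "(\<lambda>x. x ^ e * g1 x ^ Suc B * G x) analytic_on {0}"
      using g1(1) by (intro analytic_intros)
    then have "holomorphic_at_infinity (\<lambda>z. nome (z / of_nat N) ^ e * g1 (nome (z / of_nat N)) ^ Suc B * G (nome (z / of_nat N)))"
      by (rule holomorphic_at_infinityI[OF N]) simp
    moreover have "holomorphic_at_infinity (slash (k * 23) A (\<lambda>z. u z ^ Suc 22))"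
      using u1 A by (simp add: R_space_iff)
    ultimately have "holomorphic_at_infinity (\<lambda>z. slash (k * 23) A (\<lambda>z. u z ^ Suc 22) z *
        (nome (z / of_nat N) ^ e * g1 (nome (z / of_nat N)) ^ Suc B * G (nome (z / of_nat N))))"
      by (rule holomorphic_at_infinity_mult[rotated])
    then show ?thesis
    proof (rule holomorphic_at_infinity_cong)
      fix z assume z: "z \<in> upper_half_plane"
      define x where "x = nome (z / of_nat N)"
      have "slash (- k) A v z = slash 0 A p z ^ Suc B * (slash (k * 23) A (\<lambda>z. u z ^ Suc 22) z * slash (- (24 * k)) A D z)"
        using slash_mult[OF A(1) z, of 0 "k * 23 + - (24 * k)" "\<lambda>z. p z ^ Suc B" "\<lambda>z. u z ^ Suc 22 * D z"]
          slash_mult[OF A(1) z, of "k * 23" "- (24 * k)" "\<lambda>z. u z ^ Suc 22" D]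
          slash_power[of 0 "Suc B" A p z]
        unfolding wt v_def[abs_def] by (simp only: mult_zero_left)
      also have "slash 0 A p z ^ Suc B = x ^ Suc B * g1 x ^ Suc B"
        unfolding g(3)[OF z] g1(2) x_def power_mult_distrib ..
      also have "slash (- (24 * k)) A D z = x powi (- m) * G x" unfolding G(2)[OF z] x_def ..
      also have "x ^ Suc B * g1 x ^ Suc B * (slash (k * 23) A (\<lambda>z. u z ^ Suc 22) z * (x powi (- m) * G x)) =
         slash (k * 23) A (\<lambda>z. u z ^ Suc 22) z * (x powi int (Suc B) * x powi (- m) * g1 x ^ Suc B * G x)"
        by (simp only: power_int_of_nat mult_ac)
      also have "x powi int (Suc B) * x powi (- m) = x ^ e"
      proof -
        have "x powi int (Suc B) * x powi (- m) = x powi (int (Suc B) + - m)"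
          by (rule power_int_add[symmetric]) (simp add: x_def)
        then show ?thesis unfolding e power_int_of_nat .
      qed
      finally show "slash (- k) A v z = slash (k * 23) A (\<lambda>z. u z ^ Suc 22) z *
        (nome (z / of_nat N) ^ e * g1 (nome (z / of_nat N)) ^ Suc B * G (nome (z / of_nat N)))"
        unfolding x_def .
    qed
  qed
  then have "v \<in> R_space N (- k)" using vwh by (simp add: R_space_iff_weakly_holomorphic)
  moreover have "p z ^ Suc B = u z * v z" if z: "z \<in> upper_half_plane" for z
  proof -
    have "u z \<noteq> 0" unfolding u_def by (rule eta_quotient_nonzero[OF N z])
    moreover have "D z = inverse (u z ^ 24)"
      unfolding D_def Delta_quotient_def u_def using eta_quotient_powi[OF z, of N "-24" r]
      by (simp add: power_int_minus)
    moreover have "u z * u z ^ Suc 22 = u z ^ 24" by (simp flip: power_Suc)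
    ultimately have "u z * (u z ^ Suc 22 * D z) = 1"
      unfolding mult.assoc[symmetric] by simp
    then show ?thesis unfolding v_def by (metis mult.left_commute mult.right_neutral)
  qed
  ultimately show thesis using that[of "Suc B" v] by (simp add: u_def)
qed

text \<open>With the constant term \<open>c\<close> split off, \<open>Q(p) ^ n = c + p * T(p)\<close>. The left side is divisible by the
  eta-quotient and \<open>p\<close> is divisible by \<open>u\<close>; dividing by \<open>c\<close> gives the identity.\<close>

theorem unit_ideal_from_eta_quotient:
  assumes N: "N > 0" and r: "eta_quotient N r \<in> R_space N 2"
  obtains u v1 v2 where "u \<in> R_space N 2" "v1 \<in> R_space N (-2)" "v2 \<in> R_space N (-2)"
    "\<And>z. z \<in> upper_half_plane \<Longrightarrow> eta_quotient N r z * v1 z + u z * v2 z = 1"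
proof -
  obtain s where s: "good_exponents N s" using good_exponents_exist[OF N] by blast
  obtain u where u: "u \<in> R_space N 2" "\<And>A. A \<in> SL2Z \<Longrightarrow> \<not> int N dvd A $ 2 $ 1 \<Longrightarrow>
     \<exists>K. K analytic_on {0} \<and> K 0 \<noteq> 0 \<and> (\<forall>z\<in>upper_half_plane. slash 2 A u z = K (nome (z / of_nat N)))"
    using cusp_nonvanishing_weight_2_form[OF N s] by metis
  define t where "t = nat (\<Sum>\<delta> | \<delta> dvd N. s \<delta>)"
  have t: "Delta_weight N s = 12 * int t" "t > 0"
    using s by (simp_all add: t_def good_exponents_def Delta_weight_def)
  \<comment> \<open>the exponent of \<open>u\<close> that leaves weight -2 after division by \<open>F\<close> is \<open>Suc l\<close>\<close>
  define l where "l = 6 * t - 2"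
  have l: "6 * t = Suc (Suc l)" using t(2) by (simp add: l_def)
  define D where "D = Delta_quotient N (\<lambda>\<delta>. - 1 * s \<delta>)"
  have D: "D \<in> R_space N (- (12 * int t))"
    using good_Delta_quotient_power_in_E_space[OF N s, of "-1"] E_space_subset_R_space
    unfolding D_def t(1) by auto
  define v' where "v' z = u z ^ Suc l * D z" for z
  have wt: "2 * int (Suc l) + - (12 * int t) = -2" using l by (simp add: algebra_simps)
  have v': "v' \<in> R_space N (-2)"
    using R_space_mult[OF R_space_power_Suc[OF u(1), of l] D] unfolding wt v'_def[abs_def] .
  define p where "p z = u z * v' z" for z
  have p: "p \<in> R_space N 0" using R_space_mult[OF u(1) v'] by (simp add: p_def[abs_def])
  have pD: "p = (\<lambda>z. u z ^ (6 * t) * D z)" by (simp add: fun_eq_iff p_def v'_def l mult.assoc)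
  have val: "\<exists>g. g analytic_on {0} \<and> g 0 \<noteq> 0 \<and> (\<forall>z\<in>upper_half_plane. slash 0 A p z = g (nome (z / of_nat N)))"
    if A: "A \<in> SL2Z" "\<not> int N dvd A $ 2 $ 1" for A
  proof -
    obtain K where K: "K analytic_on {0}" "K 0 \<noteq> 0"
      "\<And>z. z\<in>upper_half_plane \<Longrightarrow> slash 2 A u z = K (nome (z / of_nat N))"
      using u(2)[OF A] by blast
    have wD: "Delta_weight N (\<lambda>\<delta>. - 1 * s \<delta>) = - (12 * int t)"
      using t(1) by (simp add: Delta_weight_def sum_negf)
    have oD: "cusp_order N (\<lambda>\<delta>. - 1 * s \<delta>) (A $ 2 $ 1) = 0"
      using s A(2) by (simp add: good_exponents_def cusp_order_def sum_negf)
    obtain G where G: "G holomorphic_on ball 0 1" "G 0 \<noteq> 0"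
      "\<And>z. z\<in>upper_half_plane \<Longrightarrow> slash (- (12 * int t)) A D z = G (nome (z / of_nat N))"
      using Delta_quotient_expansion[OF N A(1), of "\<lambda>\<delta>. - 1 * s \<delta>"]
      unfolding unit_expansion_def wD oD D_def[symmetric] by (auto simp del: mult_minus1)
    have "G analytic_on {0}" using G(1) by (auto simp: analytic_at intro!: exI[of _ "ball 0 1"])
    then have "(\<lambda>x. K x ^ (6 * t) * G x) analytic_on {0}" using K(1) by (intro analytic_intros)
    moreover have "slash 0 A p z = K (nome (z / of_nat N)) ^ (6 * t) * G (nome (z / of_nat N))"
      if z: "z \<in> upper_half_plane" for z
    proof -
      have "slash (2 * int (6 * t) + - (12 * int t)) A p z = slash 2 A u z ^ (6 * t) * slash (- (12 * int t)) A D z"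
        unfolding pD slash_mult[OF A(1) z] slash_power ..
      then show ?thesis by (simp add: K(3)[OF z] G(3)[OF z])
    qed
    ultimately show ?thesis using K(2) G(2) by (intro exI[of _ "\<lambda>x. K x ^ (6 * t) * G x"]) auto
  qed
  obtain V where V: "finite V" "0 \<notin> V" "\<And>A. A \<in> SL2Z \<Longrightarrow> \<not> int N dvd A $ 2 $ 1 \<Longrightarrow>
     \<exists>g. g analytic_on {0} \<and> g 0 \<in> V \<and> (\<forall>z\<in>upper_half_plane. slash 0 A p z = g (nome (z / of_nat N)))"
    using finitely_many_cusp_values[OF N p val] by metis
  define Q where "Q = (\<Prod>x\<in>V. [:- x, 1:])"
  have Q0: "poly Q 0 \<noteq> 0" using V by (auto simp: Q_def poly_prod)
  have QV: "poly Q x = 0" if "x \<in> V" for x using V(1) that by (auto simp: Q_def poly_prod)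
  define Qp where "Qp z = (if z \<in> upper_half_plane then poly Q (p z) else 0)" for z
  have Qp: "Qp \<in> R_space N 0" using poly_in_R_space_0[OF p, of Q] by (simp add: Qp_def[abs_def])
  have van: "\<exists>g. g analytic_on {0} \<and> g 0 = 0 \<and> (\<forall>z\<in>upper_half_plane. slash 0 A Qp z = g (nome (z / of_nat N)))"
    if A: "A \<in> SL2Z" "\<not> int N dvd A $ 2 $ 1" for A
  proof -
    obtain g where g: "g analytic_on {0}" "g 0 \<in> V"
      "\<And>z. z\<in>upper_half_plane \<Longrightarrow> slash 0 A p z = g (nome (z / of_nat N))"
      using V(3)[OF A] by blast
    have "(\<lambda>x. poly Q (g x)) analytic_on {0}"
      unfolding poly_altdef using g(1) by (intro analytic_intros)
    moreover have "slash 0 A Qp z = poly Q (g (nome (z / of_nat N)))" if "z \<in> upper_half_plane" for z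
      using g(3)[OF that] moebius_in_upper_half_plane[OF A(1) that] by (simp add: slash_def Qp_def)
    ultimately show ?thesis using QV[OF g(2)] by (intro exI[of _ "\<lambda>x. poly Q (g x)"]) auto
  qed
  obtain n v where n: "n > 0" and v: "v \<in> R_space N (- 2)"
    "\<And>z. z \<in> upper_half_plane \<Longrightarrow> Qp z ^ n = eta_quotient N r z * v z"
    using cusp_vanishing_divisible_by_eta_quotient[OF N r Qp van] by metis
  \<comment> \<open>separate the constant term, so that the rest is divisible by \<open>p\<close>\<close>
  obtain c T where cT: "Q ^ n = pCons c T" by (cases "Q ^ n") auto
  have "poly (Q ^ n) 0 = c" by (simp add: cT)
  then have c: "c \<noteq> 0" using Q0 by (auto simp: poly_power)
  define Tp where "Tp z = (if z \<in> upper_half_plane then poly T (p z) else 0)" for z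
  have Tp: "Tp \<in> R_space N 0" using poly_in_R_space_0[OF p, of T] by (simp add: Tp_def[abs_def])
  have v2: "(\<lambda>z. - (1 / c) * (v' z * Tp z)) \<in> R_space N (-2)"
    using R_space_scale[OF R_space_mult[OF v' Tp], of "- (1 / c)"] by simp
  show thesis
  proof (rule that[OF u(1) R_space_scale[OF v(1), of "1 / c"] v2])
    fix z assume z: "z \<in> upper_half_plane"
    have "Qp z ^ n = poly (Q ^ n) (p z)" using z by (simp add: Qp_def poly_power)
    then have "eta_quotient N r z * v z = c + p z * Tp z"
      using v(2)[OF z] z by (simp add: cT Tp_def)
    then have "eta_quotient N r z * (1 / c * v z) = 1 + u z * v' z * Tp z / c"
      using c by (simp add: p_def field_simps)
    then show "eta_quotient N r z * (1 / c * v z) + u z * (- (1 / c) * (v' z * Tp z)) = 1"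
      by (simp add: algebra_simps)
  qed
qed

section \<open>From weight 2 to all weights\<close>

lemma R_space_subset_E_space_if_eta_quotient:
  assumes N: "N > 0" and R2: "R_space N 2 \<subseteq> E_space N 2" and r: "eta_quotient N r \<in> R_space N 2"
  shows "R_space N (2 + 2 * int n) \<subseteq> E_space N (2 + 2 * int n)"
proof (induction n)
  case 0
  then show ?case using R2 by simp
next
  case (Suc n)
  obtain u v1 v2 where u: "u \<in> R_space N 2" "v1 \<in> R_space N (-2)" "v2 \<in> R_space N (-2)"
    "\<And>z. z \<in> upper_half_plane \<Longrightarrow> eta_quotient N r z * v1 z + u z * v2 z = 1"
    using unit_ideal_from_eta_quotient[OF N r] by blast
  show ?case
  proof
    fix f assume f: "f \<in> R_space N (2 + 2 * int (Suc n))"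
    have wt: "-2 + (2 + 2 * int (Suc n)) = 2 + 2 * int n" "2 + (2 + 2 * int n) = 2 + 2 * int (Suc n)" by simp_all
    have E: "(\<lambda>z. v z * f z) \<in> E_space N (2 + 2 * int n)" if "v \<in> R_space N (-2)" for v
      using R_space_mult[OF that f] Suc.IH unfolding wt by blast
    have "(\<lambda>z. eta_quotient N r z * (v1 z * f z) + u z * (v2 z * f z)) \<in> E_space N (2 + 2 * int (Suc n))"
      using E_space_add[OF E_space_mult[OF N _ E[OF u(2)]] E_space_mult[OF N _ E[OF u(3)]], of "eta_quotient N r" 2 u]
        r u(1) R2 unfolding wt by blast
    also have "(\<lambda>z. eta_quotient N r z * (v1 z * f z) + u z * (v2 z * f z)) = f"
    proof
      fix z
      show "eta_quotient N r z * (v1 z * f z) + u z * (v2 z * f z) = f z"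
      proof (cases "z \<in> upper_half_plane")
        case True
        have "eta_quotient N r z * (v1 z * f z) + u z * (v2 z * f z) =
            (eta_quotient N r z * v1 z + u z * v2 z) * f z" by (simp add: algebra_simps)
        then show ?thesis using u(4)[OF True] by simp
      qed (simp add: R_space_off[OF f])
    qed
    finally show "f \<in> E_space N (2 + 2 * int (Suc n))" .
  qed
qed

text \<open>The cusp 0 is not equivalent to infinity, so the form that does not vanish there is not zero.\<close>

lemma R_space_2_nontrivial:
  assumes N: "N > 1"
  shows "\<exists>u\<in>R_space N 2. u \<noteq> (\<lambda>z. 0)"
proof -
  have N0: "N > 0" using N by simp
  obtain s where s: "good_exponents N s" using good_exponents_exist[OF N0] by blast
  obtain u where u: "u \<in> R_space N 2" "\<And>A. A \<in> SL2Z \<Longrightarrow> \<not> int N dvd A $ 2 $ 1 \<Longrightarrow>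
     \<exists>K. K analytic_on {0} \<and> K 0 \<noteq> 0 \<and> (\<forall>z\<in>upper_half_plane. slash 2 A u z = K (nome (z / of_nat N)))"
    using cusp_nonvanishing_weight_2_form[OF N0 s] by metis
  define S :: "int ^ 2 ^ 2" where "S = vector [vector [0, -1], vector [1, 0]]"
  have "S \<in> SL2Z" "\<not> int N dvd S $ 2 $ 1" using N by (simp_all add: S_def SL2Z_def det_2)
  then obtain K where K: "K analytic_on {0}" "K 0 \<noteq> 0"
    "\<And>z. z\<in>upper_half_plane \<Longrightarrow> slash 2 S u z = K (nome (z / of_nat N))" using u(2) by blast
  have "u \<noteq> (\<lambda>z. 0)"
  proof
    assume "u = (\<lambda>z. 0)"
    then have K0: "K (nome (z / of_nat N)) = 0" if "z \<in> upper_half_plane" for z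
      using K(3)[OF that] by (simp add: slash_def)
    have "((\<lambda>n. nome (\<i> * of_nat (Suc n))) \<longlongrightarrow> 0) sequentially"
    proof -
      have "norm (nome \<i>) < 1" by (rule norm_nome_less_1) simp
      then have "(\<lambda>n. nome \<i> ^ Suc n) \<longlonglongrightarrow> 0" using LIMSEQ_power_zero LIMSEQ_Suc by blast
      then show ?thesis unfolding nome_power by (simp only: mult.commute)
    qed
    moreover have "isCont K 0" using K(1) by (rule analytic_at_imp_isCont)
    ultimately have "(\<lambda>n. K (nome (\<i> * of_nat (Suc n)))) \<longlonglongrightarrow> K 0" by (rule isCont_tendsto_compose[rotated])
    moreover have "K (nome (\<i> * of_nat (Suc n))) = 0" for n
      using K0[of "of_nat N * (\<i> * of_nat (Suc n))"] N0 by (simp add: upper_half_plane_def)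
    ultimately have "K 0 = 0" by (simp add: LIMSEQ_const_iff)
    then show False using K(2) by simp
  qed
  then show ?thesis using u(1) by blast
qed

text \<open>The derivative has to be a function of the local parameter on the whole punctured disc, whereas \<open>g\<close> is
  only known to be meromorphic at its centre. Away from it, \<open>g\<close> is \<open>f\<close> composed with a local inverse
  of the parameter.\<close>

lemma meromorphic_at_infinity_deriv:
  assumes f: "meromorphic_at_infinity f" and hol: "f holomorphic_on upper_half_plane"
  shows "meromorphic_at_infinity (deriv f)"
proof -
  obtain h :: nat and g where h: "h > 0" "g meromorphic_on {0}"
    "\<And>z. z \<in> upper_half_plane \<Longrightarrow> f z = g (nome (z / of_nat h))"
    using f unfolding meromorphic_at_infinity_eq expands_in_def by blast
  define c where "c = 2 * of_real pi * \<i> / of_nat h"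
  have c: "c \<noteq> 0" using h(1) by (simp add: c_def)
  have "deriv f z = c * nome (z / of_nat h) * deriv g (nome (z / of_nat h))" if z: "z \<in> upper_half_plane" for z
  proof -
    define x where "x = nome (z / of_nat h)"
    have x: "x \<noteq> 0" by (simp add: x_def)
    define L where "L w = z + Ln (w / x) / c" for w
    have L: "nome (L w / of_nat h) = w" if "w \<noteq> 0" for w
    proof -
      have "nome (L w / of_nat h) = exp (c * L w)" by (simp add: nome_def c_def)
      also have "c * L w = c * z + Ln (w / x)" using c by (simp add: L_def distrib_left)
      also have "exp (c * z) = x" by (simp add: x_def nome_def c_def)
      then have "exp (c * z + Ln (w / x)) = w" using x that by (simp add: exp_add)
      finally show ?thesis .
    qed
    have Lx: "L x = z" using x by (simp add: L_def)
    have Ld: "(L has_field_derivative 1 / (c * x)) (at x)"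
      unfolding L_def[abs_def] using x c
      by (auto intro!: derivative_eq_intros simp: field_simps complex_nonpos_Reals_iff)
    have "(f has_field_derivative deriv f z) (at (L x))"
      unfolding Lx by (rule holomorphic_derivI[OF hol open_upper_half_plane z])
    from DERIV_chain2[OF this Ld]
    have fL: "((\<lambda>w. f (L w)) has_field_derivative deriv f z * (1 / (c * x))) (at x)" .
    have "isCont L x" using Ld by (rule DERIV_isCont)
    then have "\<forall>\<^sub>F w in at x. L w \<in> upper_half_plane"
      unfolding isCont_def using open_upper_half_plane by (rule topological_tendstoD) (simp add: Lx z)
    then have "\<forall>\<^sub>F w in nhds x. L w \<in> upper_half_plane"
      unfolding eventually_nhds_conv_at using Lx z by simp
    moreover have "\<forall>\<^sub>F w in nhds x. w \<noteq> 0" using x by (intro t1_space_nhds) auto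
    ultimately have ev: "\<forall>\<^sub>F w in nhds x. f (L w) = g w"
    proof eventually_elim
      case (elim w)
      then show ?case using h(3)[of "L w"] L[of w] by simp
    qed
    have "(g has_field_derivative deriv f z * (1 / (c * x))) (at x)"
      using fL DERIV_cong_ev[OF refl ev refl] by simp
    then have "deriv g x = deriv f z * (1 / (c * x))" by (rule DERIV_imp_deriv)
    then show ?thesis using c x by (simp add: x_def[symmetric])
  qed
  moreover have "(\<lambda>x. c * x * deriv g x) meromorphic_on {0}"
    using h(2) by (intro meromorphic_intros)
  ultimately show ?thesis
    unfolding meromorphic_at_infinity_eq expands_in_def using h(1) by blast
qed

lemma deriv_level_1_in_R_space:
  assumes f: "f \<in> R_space 1 0"
  shows "(\<lambda>z. if z \<in> upper_half_plane then deriv f z else 0) \<in> R_space 1 2"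
proof -
  define d where "d z = (if z \<in> upper_half_plane then deriv f z else 0)" for z
  have hol: "f holomorphic_on upper_half_plane" using f by (simp add: R_space_iff)
  have Gamma: "A \<in> Gamma0 1 \<longleftrightarrow> A \<in> SL2Z" for A by (simp add: Gamma0_def)
  have inv: "slash 2 A d z = deriv f z" if A: "A \<in> SL2Z" and z: "z \<in> upper_half_plane" for A z
  proof -
    have "slash 2 A d z = slash 2 A (deriv f) z"
      by (rule slash_cong[OF A z]) (simp add: d_def)
    then show ?thesis
      using invariant_imp_deriv_invariant[OF A hol _ z] f A Gamma by (simp add: R_space_iff)
  qed
  have "meromorphic_at_infinity (deriv f)"
    by (rule meromorphic_at_infinity_deriv[OF R_space_meromorphic_at_infinity[OF f] hol])
  then have "meromorphic_at_infinity (slash 2 A d)" if "A \<in> SL2Z" for A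
    using inv[OF that] by (rule meromorphic_at_infinity_cong)
  moreover have "d holomorphic_on upper_half_plane"
    by (rule holomorphic_transform[OF holomorphic_deriv[OF hol open_upper_half_plane]]) (simp add: d_def)
  ultimately have "d \<in> R_space 1 2"
    unfolding R_space_iff using inv Gamma by (auto simp: d_def)
  then show ?thesis unfolding d_def[abs_def] .
qed

text \<open>If there are no nonzero forms of weight 2, then those of weight 0 have derivative zero. So \<open>f ^ 6 / Delta ^ l\<close> is
  constant, \<open>f / eta ^ (4 * l)\<close> takes finitely many values, and a continuous function with this property on the
  upper half plane is constant.\<close>

lemma R_space_level_1_subset_E_space_if_trivial:
  assumes R2: "\<And>u. u \<in> R_space 1 2 \<Longrightarrow> u = (\<lambda>z. 0)" and k: "even k"
  shows "R_space 1 k \<subseteq> E_space 1 k"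
proof
  fix f assume f: "f \<in> R_space 1 k"
  obtain l where l: "k = 2 * l" using k by blast
  define e where "e = eta_quotient 1 (\<lambda>_. 4 * l)"
  define D where "D = Delta_quotient 1 (\<lambda>_. - l)"
  have enz: "e z \<noteq> 0" if "z \<in> upper_half_plane" for z
    unfolding e_def using that by (intro eta_quotient_nonzero) auto
  have e6: "e z ^ 6 * D z = 1" if z: "z \<in> upper_half_plane" for z
  proof -
    have "e z ^ 6 * D z = eta_quotient 1 (\<lambda>\<delta>. 6 * (4 * l) + 24 * (- l)) z"
      unfolding e_def D_def Delta_quotient_def eta_quotient_add[OF zero_less_one]
      using eta_quotient_powi[OF z, of 1 6 "\<lambda>_. 4 * l"] by simp
    then show ?thesis using eta_quotient_0[OF z] by simp
  qed
  have D: "D \<in> R_space 1 (- (12 * l))"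
    using Delta_quotient_in_R_space[of 1 "\<lambda>_. - l"] by (simp add: D_def Delta_weight_def)
  define g where "g z = f z ^ Suc 5 * D z" for z
  have wt: "k * int (Suc 5) + - (12 * l) = 0" by (simp add: l)
  have g: "g \<in> R_space 1 0"
    using R_space_mult[OF R_space_power_Suc[OF f, of 5] D] unfolding wt g_def[abs_def] .
  have "deriv g z = 0" if "z \<in> upper_half_plane" for z
    using fun_cong[OF R2[OF deriv_level_1_in_R_space[OF g]], of z] that by simp
  then have "(g has_field_derivative 0) (at z)" if "z \<in> upper_half_plane" for z
    using holomorphic_derivI[of g upper_half_plane z] g that open_upper_half_plane by (simp add: R_space_iff)
  then obtain c where c: "\<And>z. z \<in> upper_half_plane \<Longrightarrow> g z = c"
    using DERIV_zero_connected_constant[OF connected_upper_half_plane open_upper_half_plane finite.emptyI, of g]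
      g holomorphic_on_imp_continuous_on by (metis Diff_empty R_space_iff)
  define \<psi> where "\<psi> z = f z / e z" for z
  have \<psi>6: "\<psi> z ^ 6 = c" if z: "z \<in> upper_half_plane" for z
  proof -
    have "D z = 1 / e z ^ 6" using e6[OF z] enz[OF z] by (simp add: field_simps)
    then show ?thesis using c[OF z] by (simp add: \<psi>_def g_def power_divide del: power_Suc)
  qed
  have "continuous_on upper_half_plane \<psi>"
    unfolding \<psi>_def[abs_def] using f enz eta_quotient_holomorphic[of 1]
    by (intro continuous_intros holomorphic_on_imp_continuous_on) (auto simp: R_space_iff e_def)
  moreover have "finite (\<psi> ` upper_half_plane)"
  proof (rule finite_subset)
    show "\<psi> ` upper_half_plane \<subseteq> {x. poly (monom 1 6 - [:c:]) x = 0}"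
      using \<psi>6 by (auto simp: poly_monom)
    have "coeff (monom 1 6 - [:c:]) 6 = 1" by (simp add: coeff_eq_0)
    then have "monom 1 6 - [:c:] \<noteq> 0" by (metis coeff_0 zero_neq_one)
    then show "finite {x. poly (monom 1 6 - [:c:]) x = 0}" by (rule poly_roots_finite)
  qed
  ultimately obtain b where b: "\<And>z. z \<in> upper_half_plane \<Longrightarrow> \<psi> z = b"
    using continuous_finite_range_constant[OF connected_upper_half_plane] unfolding constant_on_def by metis
  have fe: "f = (\<lambda>z. b * e z)"
  proof
    fix z
    show "f z = b * e z"
      using b[of z] enz[of z] R_space_off[OF f, of z]
      by (cases "z \<in> upper_half_plane") (auto simp: \<psi>_def e_def field_simps)
  qed
  show "f \<in> E_space 1 k"
  proof (cases "b = 0")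
    case True
    then show ?thesis using E_space_zero by (simp add: fe)
  next
    case False
    have "(\<lambda>z. 1 / b * f z) \<in> R_space 1 k" by (rule R_space_scale[OF f])
    then have "e \<in> R_space 1 k" using False by (simp add: fe)
    then have "e \<in> E_space 1 k" unfolding e_def by (rule E_space_base)
    then show ?thesis unfolding fe by (rule E_space_scale)
  qed
qed

theorem R_space_subset_E_space_if_weight_2:
  assumes N: "N > 0" and R2: "R_space N 2 \<subseteq> E_space N 2" and k: "k \<ge> 0" "even k"
  shows "R_space N k \<subseteq> E_space N k"
proof (cases "\<exists>r. eta_quotient N r \<in> R_space N 2")
  case True
  then obtain r where r: "eta_quotient N r \<in> R_space N 2" by blast
  have pos: "R_space N l \<subseteq> E_space N l" if l: "l > 0" "even l" for l
  proof -
    obtain j where j: "l = 2 * j" using l(2) by blast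
    then have "l = 2 + 2 * int (nat (j - 1))" using l(1) by simp
    then show ?thesis using R_space_subset_E_space_if_eta_quotient[OF N R2 r] by metis
  qed
  have "M_space N l \<subseteq> E_space N l" if "l > 0" "even l" for l
    using M_space_subset_R_space pos[OF that] by (rule subset_trans)
  then show ?thesis by (rule R_space_subset_E_space_if_M_space[OF N _ k])
next
  case False
  then have "R_space N 2 \<inter> range (eta_quotient N) = {}" by auto
  then have "E_space N 2 = {\<lambda>z. 0}" by (simp add: E_space_def zero_fun_def)
  then have trivial: "\<And>u. u \<in> R_space N 2 \<Longrightarrow> u = (\<lambda>z. 0)" using R2 by auto
  have "\<not> N > 1" using R_space_2_nontrivial[of N] trivial by auto
  then have "N = 1" using N by simp
  then show ?thesis
    using R_space_level_1_subset_E_space_if_trivial[OF trivial[unfolded \<open>N = 1\<close>] k(2)] by simp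
qed

theorem theorem5:
  fixes N :: nat
  assumes "N > 0"
  shows "((\<forall>k::int. k > 0 \<and> even k \<longrightarrow> M_space N k \<subseteq> E_space N k) \<longleftrightarrow>
          (\<forall>k::int. k \<ge> 0 \<and> even k \<longrightarrow> R_space N k = E_space N k)) \<and>
         ((\<forall>k::int. k \<ge> 0 \<and> even k \<longrightarrow> R_space N k = E_space N k) \<longleftrightarrow>
          R_space N 2 = E_space N 2)"
proof -
  have E: "R_space N k = E_space N k" if "R_space N k \<subseteq> E_space N k" for k
    using that E_space_subset_R_space by blast
  show ?thesis
  proof (intro conjI iffI)
    assume "\<forall>k. k > 0 \<and> even k \<longrightarrow> M_space N k \<subseteq> E_space N k"
    then have M: "M_space N k \<subseteq> E_space N k" if "k > 0" "even k" for k using that by simp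
    show "\<forall>k. k \<ge> 0 \<and> even k \<longrightarrow> R_space N k = E_space N k"
      using E[OF R_space_subset_E_space_if_M_space[OF assms M]] by simp
  next
    assume R: "\<forall>k. k \<ge> 0 \<and> even k \<longrightarrow> R_space N k = E_space N k"
    then show "\<forall>k. k > 0 \<and> even k \<longrightarrow> M_space N k \<subseteq> E_space N k"
      using M_space_subset_R_space[of N] by fastforce
    from R show "R_space N 2 = E_space N 2" by simp
  next
    assume "R_space N 2 = E_space N 2"
    then have "R_space N 2 \<subseteq> E_space N 2" by simp
    then show "\<forall>k. k \<ge> 0 \<and> even k \<longrightarrow> R_space N k = E_space N k"
      using E[OF R_space_subset_E_space_if_weight_2[OF assms]] by simp
  qed
qed

end
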